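(* Let $\mathbb{F}$ be a field, let $X$ be an $n\times m$ matrix of variables, and let $I^{n,m}_r\subseteq\mathbb{F}[X]$ be the ideal generated by the $r\times r$ minors of $X$. For every nonzero $f\in I^{n,m}_r$ we have $\dim(\partial_{<\infty}(f))\ge\binom{2r}{r}=\dim(\partial_{<\infty}(\det_r))$. In the case $\mathrm{char}(\mathbb{F})=0$, we also have $\dim(\partial_{\le d}(f))\ge\sum_{i=0}^d\binom{r}{i}^2$ for every $d\in\mathbb{N}$.
   Context: For $f(\vec x)\in\mathbb{F}[x_1,\dots,x_N]$ and $\vec a\in\mathbb{N}^N$, the Hasse derivative $\frac{\partial f}{\partial\vec x^{\vec a}}$ is the coefficient of $\vec y^{\vec a}$ in $f(\vec x+\vec y)\in\mathbb{F}[\vec x][\vec y]$. $\partial_{<\infty}(f)$ is the $\mathbb{F}$-span of all Hasse derivatives of $f$; $\partial_{\le d}(f)$ is the $\mathbb{F}$-span of the Hasse derivatives $\frac{\partial f}{\partial\vec x^{\vec a}}$ with $\|\vec a\|_1\le d$. $\det_r$ is the determinant of an $r\times r$ matrix of distinct variables. *)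

theory Defs
  imports
    "HOL-Algebra.Ideal"
    "Jordan_Normal_Form.Determinant"
    "Jordan_Normal_Form.DL_Submatrix"
    "HOL-Library.Poly_Mapping"
begin

text \<open>
  A polynomial maps exponent vectors to coefficients, both finitely supported. Only the variables
  in an explicitly given set \<open>V\<close> are meant to occur; \<open>poly_ring V\<close> below is the ring
  \<open>F[x\<^sub>v | v \<in> V]\<close> inside the type of all polynomials.
\<close>

type_synonym ('v, 'a) mpoly = "('v \<Rightarrow>\<^sub>0 nat) \<Rightarrow>\<^sub>0 'a"

definition Const :: "'a \<Rightarrow> ('v, 'a::zero) mpoly" where
  "Const c = Poly_Mapping.single 0 c"

definition Var :: "'v \<Rightarrow> ('v, 'a::zero_neq_one) mpoly" where
  "Var v = Poly_Mapping.single (Poly_Mapping.single v 1) 1"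

definition poly_ring :: "'v set \<Rightarrow> ('v, 'a::comm_ring_1) mpoly ring" where
  "poly_ring V = \<lparr> carrier = {f. \<forall>a \<in> Poly_Mapping.keys f. Poly_Mapping.keys a \<subseteq> V},
     monoid.mult = (*), one = 1, ring.zero = 0, add = (+) \<rparr>"

text \<open>\<open>evaluate \<phi> g f\<close> applies \<open>\<phi>\<close> to the coefficients of \<open>f\<close> and substitutes \<open>g v\<close> for \<open>x\<^sub>v\<close>.\<close>

definition evaluate :: "('a \<Rightarrow> 'b) \<Rightarrow> ('v \<Rightarrow> 'b) \<Rightarrow> ('v, 'a::zero) mpoly \<Rightarrow> 'b::comm_ring_1" where
  "evaluate \<phi> g f = (\<Sum>a \<in> Poly_Mapping.keys f. \<phi> (Poly_Mapping.lookup f a) *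
     (\<Prod>v \<in> Poly_Mapping.keys a. g v ^ Poly_Mapping.lookup a v))"

text \<open>
  The polynomial \<open>f(x + y) \<in> F[x][y]\<close>: the outer variables are the \<open>y\<^sub>v\<close>, and \<open>x\<^sub>v\<close> is a constant of
  the outer ring.
\<close>

definition shift :: "('v, 'a::comm_ring_1) mpoly \<Rightarrow> ('v, ('v, 'a) mpoly) mpoly" where
  "shift f = evaluate (\<lambda>c. Const (Const c)) (\<lambda>v. Const (Var v) + Var v) f"

definition hasse_deriv :: "('v \<Rightarrow>\<^sub>0 nat) \<Rightarrow> ('v, 'a::comm_ring_1) mpoly \<Rightarrow> ('v, 'a) mpoly" where
  "hasse_deriv a f = Poly_Mapping.lookup (shift f) a"

definition scale :: "'a::comm_ring_1 \<Rightarrow> ('v, 'a) mpoly \<Rightarrow> ('v, 'a) mpoly" where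
  "scale c f = Const c * f"

definition norm1 :: "('v \<Rightarrow>\<^sub>0 nat) \<Rightarrow> nat" where
  "norm1 a = (\<Sum>v \<in> Poly_Mapping.keys a. Poly_Mapping.lookup a v)"

text \<open>The spans of the Hasse derivatives with respect to the variables in \<open>V\<close>.\<close>

definition hasse_space :: "'v set \<Rightarrow> ('v, 'a::field) mpoly \<Rightarrow> ('v, 'a) mpoly set" where
  "hasse_space V f = module.span scale {hasse_deriv a f | a. Poly_Mapping.keys a \<subseteq> V}"

definition hasse_space_le ::
  "'v set \<Rightarrow> nat \<Rightarrow> ('v, 'a::field) mpoly \<Rightarrow> ('v, 'a) mpoly set" where
  "hasse_space_le V d f = module.span scale
     {hasse_deriv a f | a. Poly_Mapping.keys a \<subseteq> V \<and> norm1 a \<le> d}"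

text \<open>
  \<open>vector_space.dim\<close> is \<open>0\<close> on infinite-dimensional spaces; this does not matter here, since a
  polynomial has only finitely many nonzero Hasse derivatives.
\<close>

abbreviation dimension :: "('v, 'a::field) mpoly set \<Rightarrow> nat" where
  "dimension S \<equiv> vector_space.dim scale S"

definition mat_vars :: "nat \<Rightarrow> nat \<Rightarrow> (nat \<times> nat) set" where
  "mat_vars n m = {..<n} \<times> {..<m}"

definition generic_mat :: "nat \<Rightarrow> nat \<Rightarrow> (nat \<times> nat, 'a::comm_ring_1) mpoly mat" where
  "generic_mat n m = mat n m Var"

definition generic_det :: "nat \<Rightarrow> (nat \<times> nat, 'a::comm_ring_1) mpoly" where
  "generic_det r = det (generic_mat r r)"

definition minors :: "nat \<Rightarrow> 'b::comm_ring_1 mat \<Rightarrow> 'b set" where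
  "minors r A = {det (submatrix A I J) | I J.
     I \<subseteq> {..<dim_row A} \<and> card I = r \<and> J \<subseteq> {..<dim_col A} \<and> card J = r}"

definition det_ideal :: "nat \<Rightarrow> nat \<Rightarrow> nat \<Rightarrow> (nat \<times> nat, 'a::field) mpoly set" where
  "det_ideal n m r = Idl\<^bsub>poly_ring (mat_vars n m)\<^esub> (minors r (generic_mat n m))"

lemma vector_space_scale: "vector_space (scale :: 'a::field \<Rightarrow> ('v, 'a) mpoly \<Rightarrow> _)"
  by unfold_locales
    (simp_all add: scale_def Const_def distrib_left distrib_right single_add mult_single
      flip: mult.assoc)

lemma cring_poly_ring: "cring (poly_ring V :: ('v, 'a::comm_ring_1) mpoly ring)"
proof -
  let ?C = "{f :: ('v, 'a) mpoly. \<forall>a \<in> Poly_Mapping.keys f. Poly_Mapping.keys a \<subseteq> V}"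
  have add: "f + g \<in> ?C" if "f \<in> ?C" "g \<in> ?C" for f g
    using that Poly_Mapping.keys_add[of f g] by blast
  have mult: "f * g \<in> ?C" if f: "f \<in> ?C" and g: "g \<in> ?C" for f g
  proof (rule CollectI, rule ballI)
    fix c assume "c \<in> Poly_Mapping.keys (f * g)"
    then obtain a b where ab: "c = a + b" "a \<in> Poly_Mapping.keys f" "b \<in> Poly_Mapping.keys g"
      using Poly_Mapping.keys_mult[of f g] by blast
    then show "Poly_Mapping.keys c \<subseteq> V"
      using f g Poly_Mapping.keys_add[of a b] by blast
  qed
  have zero: "0 \<in> ?C"
    by simp
  have one: "1 \<in> ?C"
    by (simp flip: single_one)
  have neg: "\<exists>g \<in> ?C. g + f = 0" if "f \<in> ?C" for f
    using that by (intro bexI[of _ "- f"]) simp_all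
  show ?thesis
  proof (intro cringI abelian_groupI comm_monoidI)
  qed (use add mult zero one neg in \<open>simp_all add: poly_ring_def algebra_simps del: mem_Collect_eq\<close>)
qed

end

theory Submission
  imports Defs "HOL-Computational_Algebra.Formal_Laurent_Series"
begin

text \<open>
  Let \<open>K\<close> be the field of Laurent series over \<open>F\<close>. A nonzero \<open>f\<close> in the ideal vanishes on all matrices of
  rank less than \<open>r\<close>. Take the least \<open>k\<close> such that \<open>f\<close> does not vanish on the matrices \<open>U V\<close> over \<open>K\<close> with
  inner dimension \<open>k\<close>; then \<open>k \<ge> r\<close>, and for suitable \<open>U\<close>, \<open>V\<close> the polynomial \<open>g(X) = f(U X V)\<close> in the
  entries of a \<open>k \<times> k\<close> matrix is nonzero but vanishes on singular matrices. By the chain rule, the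
  derivatives of \<open>g\<close> lie in the \<open>K\<close>-span of those of \<open>f\<close> after the substitution, so it suffices to
  find many independent derivatives of \<open>g\<close>.

  Evaluating \<open>g\<close> at singular matrices whose entries are close to powers of the Laurent variable shows that for each permutation
  \<open>\<pi>\<close> some monomial \<open>m\<close> of \<open>g\<close> is divisible by all \<open>x\<close> with index \<open>(i, \<pi> i)\<close>, and that all these \<open>m\<close> can be chosen with
  the same, maximal, row and column sums. For index sets \<open>I\<close>, \<open>J\<close> of equal size choose \<open>\<pi>\<close> with \<open>\<pi>(I) = J\<close>
  and differentiate along the part of \<open>m\<close> on the graph of \<open>\<pi>\<close> over \<open>I\<close> (in characteristic 0 only once
  in each of these variables). The leading parts of these derivatives are nonzero, and their row and column sums
  determine \<open>I\<close> and \<open>J\<close>, so the derivatives are independent. Their number is the sum of the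
  squares of the binomial coefficients of \<open>k\<close>.

  For the determinant, the derivatives along graphs with the same \<open>I\<close> and \<open>J\<close> agree up to sign, which
  gives the matching upper bound.
\<close>

subsection \<open>Evaluation of polynomials\<close>

definition monom_value :: "('v \<Rightarrow> 'b) \<Rightarrow> ('v \<Rightarrow>\<^sub>0 nat) \<Rightarrow> 'b::comm_ring_1" where
  "monom_value g a = (\<Prod>v \<in> Poly_Mapping.keys a. g v ^ Poly_Mapping.lookup a v)"

lemma monom_value_superset:
  assumes "finite V" "Poly_Mapping.keys a \<subseteq> V"
  shows "monom_value g a = (\<Prod>v\<in>V. g v ^ Poly_Mapping.lookup a v)"
  unfolding monom_value_def using assms
  by (intro prod.mono_neutral_left) (auto simp: in_keys_iff)

lemma monom_value_add: "monom_value g (a + b) = monom_value g a * monom_value g b"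
proof -
  let ?V = "Poly_Mapping.keys a \<union> Poly_Mapping.keys b"
  show ?thesis
    using monom_value_superset[of ?V a g] monom_value_superset[of ?V b g]
      monom_value_superset[of ?V "a + b" g] Poly_Mapping.keys_add[of a b]
    by (simp add: lookup_add power_add prod.distrib)
qed

lemma monom_value_0 [simp]: "monom_value g 0 = 1"
  by (simp add: monom_value_def)

lemma monom_value_single [simp]: "monom_value g (Poly_Mapping.single v n) = g v ^ n"
  by (simp add: monom_value_def)

lemma evaluate_altdef:
  "evaluate \<phi> g f = (\<Sum>a \<in> Poly_Mapping.keys f. \<phi> (Poly_Mapping.lookup f a) * monom_value g a)"
  by (simp add: evaluate_def monom_value_def)

lemma evaluate_superset:
  assumes "finite S" "Poly_Mapping.keys f \<subseteq> S" "\<phi> 0 = 0"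
  shows "evaluate \<phi> g f = (\<Sum>a\<in>S. \<phi> (Poly_Mapping.lookup f a) * monom_value g a)"
  unfolding evaluate_altdef using assms
  by (intro sum.mono_neutral_left) (auto simp: in_keys_iff)

lemma poly_mapping_sum_single:
  "f = (\<Sum>a\<in>Poly_Mapping.keys f. Poly_Mapping.single a (Poly_Mapping.lookup f a))"
  by (rule poly_mapping_eqI)
    (simp add: lookup_sum lookup_single when_def not_in_keys_iff_lookup_eq_zero)

context comm_ring_hom
begin

lemma evaluate_single [simp]: "evaluate hom g (Poly_Mapping.single a c) = hom c * monom_value g a"
  by (cases "c = 0") (simp_all add: evaluate_altdef)

lemma evaluate_0 [simp]: "evaluate hom g 0 = 0"
  by (simp add: evaluate_altdef)

lemma evaluate_add: "evaluate hom g (f + f') = evaluate hom g f + evaluate hom g f'"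
proof -
  let ?S = "Poly_Mapping.keys f \<union> Poly_Mapping.keys f'"
  show ?thesis
    using evaluate_superset[of ?S f hom g] evaluate_superset[of ?S f' hom g]
      evaluate_superset[of ?S "f + f'" hom g] Poly_Mapping.keys_add[of f f']
    by (simp add: lookup_add hom_add distrib_right sum.distrib)
qed

lemma evaluate_sum: "evaluate hom g (\<Sum>i\<in>I. f i) = (\<Sum>i\<in>I. evaluate hom g (f i))"
  by (induction I rule: infinite_finite_induct) (simp_all add: evaluate_add)

lemma evaluate_mult: "evaluate hom g (f * f') = evaluate hom g f * evaluate hom g f'"
proof -
  have "f * f' = (\<Sum>a\<in>Poly_Mapping.keys f. \<Sum>b\<in>Poly_Mapping.keys f'.
      Poly_Mapping.single (a + b) (Poly_Mapping.lookup f a * Poly_Mapping.lookup f' b))"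
    by (subst poly_mapping_sum_single[of f], subst poly_mapping_sum_single[of f'])
      (simp only: sum_product mult_single)
  then have "evaluate hom g (f * f') = (\<Sum>a\<in>Poly_Mapping.keys f. \<Sum>b\<in>Poly_Mapping.keys f'.
      hom (Poly_Mapping.lookup f a * Poly_Mapping.lookup f' b) * monom_value g (a + b))"
    by (simp only: evaluate_sum evaluate_single)
  then show ?thesis
    by (simp add: evaluate_altdef sum_product hom_mult monom_value_add mult_ac)
qed

lemma evaluate_Const [simp]: "evaluate hom g (Const c) = hom c"
  by (simp add: Const_def)

lemma evaluate_Var [simp]: "evaluate hom g (Var v) = g v"
  by (simp add: Var_def)

lemma evaluate_hom: "comm_ring_hom (evaluate hom g)"
  by unfold_locales (simp_all add: evaluate_add evaluate_mult flip: single_one)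

lemma hom_monom_value: "hom (monom_value g a) = monom_value (\<lambda>v. hom (g v)) a"
  by (simp add: monom_value_def hom_prod hom_power)

text \<open>Lets a ring homomorphism pass inside a substitution, so that \<open>shift\<close> or
  \<open>linear_subst\<close> followed by an evaluation collapses into a single evaluation.\<close>

lemma hom_evaluate: "hom (evaluate \<psi> g f) = evaluate (\<lambda>c. hom (\<psi> c)) (\<lambda>v. hom (g v)) f"
  by (simp add: evaluate_altdef hom_sum hom_mult hom_monom_value)

end

lemma Const_hom: "comm_ring_hom (Const :: 'a::comm_ring_1 \<Rightarrow> ('v, 'a) mpoly)"
  by unfold_locales (simp_all add: Const_def single_add mult_single)

lemma comm_ring_hom_comp:
  assumes "comm_ring_hom f" "comm_ring_hom g"
  shows "comm_ring_hom (\<lambda>x. f (g x))"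
proof -
  interpret f: comm_ring_hom f by fact
  interpret g: comm_ring_hom g by fact
  show ?thesis
    by unfold_locales (simp_all add: f.hom_add g.hom_add f.hom_mult g.hom_mult)
qed

lemma comm_ring_hom_id: "comm_ring_hom (\<lambda>x::'a::comm_ring_1. x)"
  by unfold_locales simp_all

section \<open>Coefficients of a product with one monomial\<close>

lemma lookup_single_mult_add:
  fixes h :: "('k::cancel_comm_monoid_add) \<Rightarrow>\<^sub>0 ('b::comm_ring_1)"
  shows "Poly_Mapping.lookup (Poly_Mapping.single e x * h) (e + c) = x * Poly_Mapping.lookup h c"
proof -
  have "Poly_Mapping.single e x * h = (\<Sum>b\<in>Poly_Mapping.keys h.
      Poly_Mapping.single (e + b) (x * Poly_Mapping.lookup h b))"
    by (subst poly_mapping_sum_single[of h]) (simp only: sum_distrib_left mult_single)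
  then show ?thesis
    by (simp add: lookup_sum lookup_single when_def not_in_keys_iff_lookup_eq_zero)
qed

lemma lookup_single_mult_eq_0:
  fixes h :: "('k::cancel_comm_monoid_add) \<Rightarrow>\<^sub>0 ('b::comm_ring_1)"
  assumes "\<And>b. c \<noteq> e + b"
  shows "Poly_Mapping.lookup (Poly_Mapping.single e x * h) c = 0"
proof -
  have "Poly_Mapping.single e x * h = (\<Sum>b\<in>Poly_Mapping.keys h.
      Poly_Mapping.single (e + b) (x * Poly_Mapping.lookup h b))"
    by (subst poly_mapping_sum_single[of h]) (simp only: sum_distrib_left mult_single)
  then show ?thesis
    using assms[symmetric] by (simp add: lookup_sum lookup_single_not_eq)
qed

lemma lookup_Const_mult [simp]:
  "Poly_Mapping.lookup (Const c * h) a = c * Poly_Mapping.lookup (h :: ('v, 'a::comm_ring_1) mpoly) a"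
  using lookup_single_mult_add[of 0 c h a] by (simp add: Const_def)

lemma exponent_decompose:
  assumes "Poly_Mapping.lookup a v \<noteq> (0::nat)"
  shows "Poly_Mapping.single v 1 + (a - Poly_Mapping.single v 1) = a"
  using assms by (intro poly_mapping_eqI) (auto simp: lookup_add lookup_minus lookup_single when_def)

lemma lookup_Var_mult:
  "Poly_Mapping.lookup (Var v * h) a =
    (if Poly_Mapping.lookup a v = 0 then 0
     else Poly_Mapping.lookup (h :: ('v, 'a::comm_ring_1) mpoly) (a - Poly_Mapping.single v 1))"
proof (cases "Poly_Mapping.lookup a v = 0")
  case True
  then have "a \<noteq> Poly_Mapping.single v 1 + b" for b
    by (auto simp: lookup_add)
  then show ?thesis
    using True lookup_single_mult_eq_0[of a "Poly_Mapping.single v 1" 1 h] by (simp add: Var_def)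
next
  case False
  from exponent_decompose[OF this] show ?thesis
    using False lookup_single_mult_add[of "Poly_Mapping.single v 1" 1 h "a - Poly_Mapping.single v 1"]
    by (simp add: Var_def)
qed

subsection \<open>Coefficients of Hasse derivatives\<close>

lemma norm1_superset:
  assumes "finite V" "Poly_Mapping.keys a \<subseteq> V"
  shows "norm1 a = (\<Sum>v\<in>V. Poly_Mapping.lookup a v)"
  unfolding norm1_def using assms
  by (intro sum.mono_neutral_left) (auto simp: in_keys_iff)

lemma norm1_0 [simp]: "norm1 0 = 0"
  by (simp add: norm1_def)

lemma norm1_single [simp]: "norm1 (Poly_Mapping.single v n) = n"
  by (simp add: norm1_def)

lemma norm1_add: "norm1 (a + b) = norm1 a + norm1 b"
proof -
  let ?V = "Poly_Mapping.keys a \<union> Poly_Mapping.keys b"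
  show ?thesis
    using norm1_superset[of ?V a] norm1_superset[of ?V b] norm1_superset[of ?V "a + b"]
      Poly_Mapping.keys_add[of a b]
    by (simp add: lookup_add sum.distrib)
qed

text \<open>Builds a monomial one variable at a time, matching the recursion of
  \<open>hasse_deriv_Var_mult\<close>.\<close>

lemma exponent_induct [case_names zero add]:
  fixes P :: "('v \<Rightarrow>\<^sub>0 nat) \<Rightarrow> bool"
  assumes "P 0" and step: "\<And>v a. P a \<Longrightarrow> P (Poly_Mapping.single v 1 + a)"
  shows "P a"
proof (induction "norm1 a" arbitrary: a rule: less_induct)
  case less
  show ?case
  proof (cases "a = 0")
    case False
    then obtain v where "Poly_Mapping.lookup a v \<noteq> 0"
      by (metis lookup_zero poly_mapping_eqI)
    note eq = exponent_decompose[OF this]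
    have "norm1 (a - Poly_Mapping.single v 1) < norm1 a"
      using norm1_add[of "Poly_Mapping.single v 1" "a - Poly_Mapping.single v 1"]
      unfolding eq norm1_single by linarith
    from step[OF less[OF this], of v] show ?thesis
      unfolding eq .
  qed (simp add: assms)
qed

interpretation Const2: comm_ring_hom
  "\<lambda>c::'a::comm_ring_1. Const (Const c) :: ('v, ('v, 'a) mpoly) mpoly"
  by (rule comm_ring_hom_comp[OF Const_hom Const_hom])

lemma shift_hom: "comm_ring_hom (shift :: ('v, 'a::comm_ring_1) mpoly \<Rightarrow> _)"
  unfolding shift_def[abs_def] by (rule Const2.evaluate_hom)

interpretation shift: comm_ring_hom "shift :: ('v, 'a::comm_ring_1) mpoly \<Rightarrow> _"
  by (rule shift_hom)

lemma shift_Const: "shift (Const c) = Const (Const c)"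
  by (simp add: shift_def)

lemma shift_Var: "shift (Var v) = Const (Var v) + Var v"
  by (simp add: shift_def)

lemma hasse_deriv_sum: "hasse_deriv a (\<Sum>i\<in>I. f i) = (\<Sum>i\<in>I. hasse_deriv a (f i))"
  by (simp add: hasse_deriv_def shift.hom_sum lookup_sum)

text \<open>\<open>shift\<close> is multiplicative and sends the variable to a sum: its inner
  summand leaves the outer exponent alone, its outer summand raises it by one.\<close>

lemma hasse_deriv_Var_mult:
  "hasse_deriv a (Var v * f) = Var v * hasse_deriv a f +
    (if Poly_Mapping.lookup a v = 0 then 0 else hasse_deriv (a - Poly_Mapping.single v 1) f)"
  by (simp add: hasse_deriv_def shift.hom_mult shift_Var distrib_right lookup_add lookup_Var_mult)

text \<open>The multi-index binomial of \<open>a + c\<close> over \<open>a\<close>. The argument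
  \<open>c\<close> is the exponent left after differentiating, which avoids truncated
  subtraction.\<close>

definition exponent_binomial :: "('v \<Rightarrow>\<^sub>0 nat) \<Rightarrow> ('v \<Rightarrow>\<^sub>0 nat) \<Rightarrow> nat" where
  "exponent_binomial a c = (\<Prod>v\<in>Poly_Mapping.keys a.
     (Poly_Mapping.lookup a v + Poly_Mapping.lookup c v) choose Poly_Mapping.lookup a v)"

lemma exponent_binomial_0 [simp]: "exponent_binomial 0 c = 1"
  by (simp add: exponent_binomial_def)

lemma exponent_binomial_superset:
  assumes "finite V" "Poly_Mapping.keys a \<subseteq> V"
  shows "exponent_binomial a c = (\<Prod>v\<in>V.
     (Poly_Mapping.lookup a v + Poly_Mapping.lookup c v) choose Poly_Mapping.lookup a v)"
  unfolding exponent_binomial_def using assms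
  by (intro prod.mono_neutral_left) (auto simp: in_keys_iff)

text \<open>Pascal's rule in the factor of \<open>v\<close>; the other factors agree on both sides.
  The hypothesis excludes 0 choose 0, which is 1 without any predecessor.\<close>

lemma exponent_binomial_pascal:
  assumes "Poly_Mapping.lookup a v + Poly_Mapping.lookup c v \<noteq> 0"
  shows "exponent_binomial a c =
    (if Poly_Mapping.lookup c v = 0 then 0 else exponent_binomial a (c - Poly_Mapping.single v 1)) +
    (if Poly_Mapping.lookup a v = 0 then 0 else exponent_binomial (a - Poly_Mapping.single v 1) c)"
proof -
  define V where "V = Poly_Mapping.keys a - {v}"
  define P where "P = (\<Prod>w\<in>V.
     (Poly_Mapping.lookup a w + Poly_Mapping.lookup c w) choose Poly_Mapping.lookup a w)"
  have V: "finite (insert v V)" "v \<notin> V" "Poly_Mapping.keys a \<subseteq> insert v V"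
    by (auto simp: V_def)
  moreover have "Poly_Mapping.keys (a - Poly_Mapping.single v 1) \<subseteq> insert v V"
    by (auto simp: V_def in_keys_iff lookup_minus)
  ultimately have eqs:
    "exponent_binomial a c = (Poly_Mapping.lookup a v + Poly_Mapping.lookup c v
        choose Poly_Mapping.lookup a v) * P"
    "exponent_binomial a (c - Poly_Mapping.single v 1) =
       (Poly_Mapping.lookup a v + (Poly_Mapping.lookup c v - 1) choose Poly_Mapping.lookup a v) * P"
    "exponent_binomial (a - Poly_Mapping.single v 1) c =
       ((Poly_Mapping.lookup a v - 1) + Poly_Mapping.lookup c v
         choose (Poly_Mapping.lookup a v - 1)) * P"
    unfolding P_def
    by (auto simp: exponent_binomial_superset[of "insert v V"] lookup_minus lookup_single when_def
      intro!: prod.cong)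
  show ?thesis
    unfolding eqs using assms
    by (cases "Poly_Mapping.lookup a v"; cases "Poly_Mapping.lookup c v")
      (simp_all add: distrib_right)
qed

text \<open>Induction on the monomial: one more variable subjects both sides to the same Pascal
  recursion. If neither \<open>a\<close> nor \<open>c\<close> contains that variable, both sides are
  zero.\<close>

lemma lookup_hasse_deriv_single:
  "Poly_Mapping.lookup (hasse_deriv a (Poly_Mapping.single m x)) c =
    of_nat (exponent_binomial a c) * Poly_Mapping.lookup (Poly_Mapping.single m x) (a + c)"
proof (induction m arbitrary: a c rule: exponent_induct)
  case zero
  have "a = 0" "c = 0" if "a + c = 0"
  proof -
    have "Poly_Mapping.lookup a v + Poly_Mapping.lookup c v = 0" for v
      using that by (metis lookup_add lookup_zero)
    then show "a = 0" "c = 0"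
      by (auto intro!: poly_mapping_eqI)
  qed
  moreover have "Poly_Mapping.single 0 x = Const x"
    by (simp add: Const_def)
  ultimately show ?case
    unfolding hasse_deriv_def \<open>Poly_Mapping.single 0 x = Const x\<close> shift_Const
    by (cases "a = 0 \<and> c = 0") (auto simp: Const_def lookup_single when_def)
next
  case (add v m)
  let ?e = "Poly_Mapping.single v (1::nat)"
  have step: "Poly_Mapping.single (?e + m) x = Var v * Poly_Mapping.single m x"
    by (simp add: Var_def mult_single)
  show ?case
  proof (cases "Poly_Mapping.lookup a v + Poly_Mapping.lookup c v = 0")
    case True
    then show ?thesis
      unfolding step by (simp add: hasse_deriv_Var_mult lookup_Var_mult lookup_add)
  next
    case False
    have "a + (c - ?e) = a + c - ?e" if "Poly_Mapping.lookup c v \<noteq> 0"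
      using that by (intro poly_mapping_eqI) (auto simp: lookup_add lookup_minus lookup_single when_def)
    moreover have "a - ?e + c = a + c - ?e" if "Poly_Mapping.lookup a v \<noteq> 0"
      using that by (intro poly_mapping_eqI) (auto simp: lookup_add lookup_minus lookup_single when_def)
    moreover have "Poly_Mapping.lookup (Var v * Poly_Mapping.single m x) (a + c) =
        Poly_Mapping.lookup (Poly_Mapping.single m x) (a + c - ?e)"
      using False by (auto simp: lookup_Var_mult lookup_add)
    ultimately show ?thesis
      unfolding step hasse_deriv_Var_mult exponent_binomial_pascal[OF False] lookup_add
        lookup_Var_mult[of v "hasse_deriv a (Poly_Mapping.single m x)"]
      by (cases "Poly_Mapping.lookup a v = 0"; cases "Poly_Mapping.lookup c v = 0")
        (simp_all only: add.IH if_True if_False simp_thms of_nat_add of_nat_0 distrib_right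
           mult_zero_left add_0_left add_0_right lookup_zero not_False_eq_True)
  qed
qed

text \<open>By linearity from the case of a monomial. Later claims that a coefficient of a
  derivative is or is not zero are read off from this formula.\<close>

lemma lookup_hasse_deriv:
  "Poly_Mapping.lookup (hasse_deriv a f) c =
    of_nat (exponent_binomial a c) * Poly_Mapping.lookup f (a + c)"
proof -
  have "Poly_Mapping.lookup (hasse_deriv a f) c =
      (\<Sum>m\<in>Poly_Mapping.keys f. of_nat (exponent_binomial a c) *
        Poly_Mapping.lookup (Poly_Mapping.single m (Poly_Mapping.lookup f m)) (a + c))"
    by (subst poly_mapping_sum_single[of f])
      (simp only: hasse_deriv_sum lookup_sum lookup_hasse_deriv_single)
  also have "\<dots> = of_nat (exponent_binomial a c) * Poly_Mapping.lookup f (a + c)"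
    using arg_cong[OF poly_mapping_sum_single[of f], of "\<lambda>h. Poly_Mapping.lookup h (a + c)"]
    by (simp only: sum_distrib_left[symmetric] lookup_sum)
  finally show ?thesis .
qed

text \<open>Taylor expansion: in f(x + y), put \<open>p\<close> for the inner and \<open>q\<close>
  for the outer variables, and expand by outer monomials.\<close>

lemma evaluate_hasse_expansion:
  fixes \<psi> :: "'a::comm_ring_1 \<Rightarrow> 'b::comm_ring_1"
  assumes "comm_ring_hom \<psi>"
  shows "evaluate \<psi> (\<lambda>v. p v + q v) f =
    (\<Sum>a\<in>Poly_Mapping.keys (shift f). evaluate \<psi> p (hasse_deriv a f) * monom_value q a)"
proof -
  interpret \<psi>: comm_ring_hom \<psi> by fact
  interpret p: comm_ring_hom "evaluate \<psi> p" by (rule \<psi>.evaluate_hom)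
  interpret pq: comm_ring_hom "evaluate (evaluate \<psi> p) q" by (rule p.evaluate_hom)
  have "evaluate (evaluate \<psi> p) q (shift f) = evaluate \<psi> (\<lambda>v. p v + q v) f"
    unfolding shift_def by (simp add: pq.hom_evaluate pq.hom_add)
  then show ?thesis
    by (simp only: evaluate_altdef[of "evaluate \<psi> p"] hasse_deriv_def)
qed

subsection \<open>Linear substitutions and dimension\<close>

interpretation Const: comm_ring_hom "Const :: 'a::comm_ring_1 \<Rightarrow> ('v, 'a) mpoly"
  by (rule Const_hom)

text \<open>Homogeneous forms in the outer variables whose coefficients are scalars, free of the
  inner variables. This is what makes the chain rule a linear combination with scalar
  coefficients.\<close>

definition outer_forms :: "nat \<Rightarrow> ('v, ('w, 'a::comm_ring_1) mpoly) mpoly set" where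
  "outer_forms d = {Q. \<forall>b. Poly_Mapping.lookup Q b \<in> range Const \<and>
     (Poly_Mapping.lookup Q b \<noteq> 0 \<longrightarrow> norm1 b = d)}"

lemma sum_in_range_Const:
  assumes "\<And>i. i \<in> I \<Longrightarrow> f i \<in> range (Const :: 'a::comm_ring_1 \<Rightarrow> ('v, 'a) mpoly)"
  shows "(\<Sum>i\<in>I. f i) \<in> range Const"
proof -
  from assms have "\<forall>i. \<exists>c. i \<in> I \<longrightarrow> f i = Const c" by blast
  then obtain c where "\<And>i. i \<in> I \<Longrightarrow> f i = Const (c i)" by metis
  then have "(\<Sum>i\<in>I. f i) = Const (\<Sum>i\<in>I. c i)" by (simp add: Const.hom_sum)
  then show ?thesis by blast
qed

lemma zero_in_range_Const: "0 \<in> range (Const :: 'a::comm_ring_1 \<Rightarrow> ('v, 'a) mpoly)"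
  by (rule range_eqI[of _ _ 0]) simp

lemma mult_in_range_Const:
  "x \<in> range (Const :: 'a::comm_ring_1 \<Rightarrow> ('v, 'a) mpoly) \<Longrightarrow> y \<in> range Const \<Longrightarrow> x * y \<in> range Const"
  by (auto simp flip: Const.hom_mult)

lemma outer_forms_sum:
  assumes "\<And>i. i \<in> I \<Longrightarrow> f i \<in> outer_forms d"
  shows "(\<Sum>i\<in>I. f i) \<in> outer_forms d"
  unfolding outer_forms_def mem_Collect_eq lookup_sum
proof (intro allI conjI impI)
  show "(\<Sum>i\<in>I. Poly_Mapping.lookup (f i) b) \<in> range Const" for b
    using assms by (intro sum_in_range_Const) (simp add: outer_forms_def)
  show "norm1 b = d" if "(\<Sum>i\<in>I. Poly_Mapping.lookup (f i) b) \<noteq> 0" for b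
    using that assms unfolding outer_forms_def by (metis (mono_tags, lifting) mem_Collect_eq sum.neutral)
qed

lemma outer_forms_mult:
  assumes "P \<in> outer_forms d" "Q \<in> outer_forms e"
  shows "P * Q \<in> outer_forms (d + e)"
proof -
  have *: "Poly_Mapping.single (a + b) (Poly_Mapping.lookup P a * Poly_Mapping.lookup Q b)
      \<in> outer_forms (d + e)" for a b
    using assms
    by (auto simp: outer_forms_def lookup_single when_def norm1_add zero_in_range_Const
        intro!: mult_in_range_Const)
       (metis mult_zero_left mult_zero_right)
  have "P * Q = (\<Sum>a\<in>Poly_Mapping.keys P. \<Sum>b\<in>Poly_Mapping.keys Q.
      Poly_Mapping.single (a + b) (Poly_Mapping.lookup P a * Poly_Mapping.lookup Q b))"
    by (subst poly_mapping_sum_single[of P], subst poly_mapping_sum_single[of Q])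
      (simp only: sum_product mult_single)
  then show ?thesis
    using * by (simp add: outer_forms_sum)
qed

lemma outer_forms_1: "1 \<in> outer_forms 0"
  by (auto simp: outer_forms_def lookup_one when_def zero_in_range_Const intro: range_eqI[of _ _ 1])

lemma outer_forms_power: "Q \<in> outer_forms d \<Longrightarrow> Q ^ n \<in> outer_forms (n * d)"
  by (induction n) (auto simp: outer_forms_1 outer_forms_mult)

lemma outer_forms_monom_value:
  assumes "\<And>v. q v \<in> outer_forms 1"
  shows "monom_value q a \<in> outer_forms (norm1 a)"
proof -
  have "(\<Prod>v\<in>V. q v ^ Poly_Mapping.lookup a v) \<in>
      outer_forms (\<Sum>v\<in>V. Poly_Mapping.lookup a v)" if "finite V" for V
    using that
  proof induction
    case (insert v V)
    then show ?case
      using outer_forms_mult[OF outer_forms_power[OF assms]] by simp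
  qed (simp add: outer_forms_1)
  then show ?thesis
    by (simp add: monom_value_def norm1_def)
qed

section \<open>Linear substitutions with a change of coefficients, and the chain rule\<close>

definition linear_subst :: "('v \<Rightarrow> 'w \<Rightarrow> 'k) \<Rightarrow> 'w set \<Rightarrow> ('a \<Rightarrow> 'k) \<Rightarrow>
    ('v, 'a::comm_ring_1) mpoly \<Rightarrow> ('w, 'k::comm_ring_1) mpoly" where
  "linear_subst l W \<phi> = evaluate (\<lambda>c. Const (\<phi> c)) (\<lambda>v. \<Sum>w\<in>W. Const (l v w) * Var w)"

lemma linear_subst_hom:
  assumes "comm_ring_hom \<phi>"
  shows "comm_ring_hom (linear_subst l W \<phi>)"
  unfolding linear_subst_def
  by (rule comm_ring_hom.evaluate_hom[OF comm_ring_hom_comp[OF Const_hom assms]])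

lemma linear_subst_scale:
  fixes \<phi> :: "'a::comm_ring_1 \<Rightarrow> 'k::comm_ring_1" and l :: "'v \<Rightarrow> 'w \<Rightarrow> 'k"
  assumes "comm_ring_hom \<phi>"
  shows "linear_subst l W \<phi> (scale c f) = scale (\<phi> c) (linear_subst l W \<phi> f)"
proof -
  interpret comm_ring_hom "\<lambda>c. Const (\<phi> c) :: ('w, 'k) mpoly"
    by (rule comm_ring_hom_comp[OF Const_hom assms])
  show ?thesis
    by (simp add: linear_subst_def scale_def evaluate_mult)
qed

lemma evaluate_linear_subst:
  fixes \<phi> :: "'a::comm_ring_1 \<Rightarrow> 'k::comm_ring_1"
  assumes "comm_ring_hom \<phi>"
  shows "evaluate (\<lambda>x. x) g (linear_subst l W \<phi> f) = evaluate \<phi> (\<lambda>v. \<Sum>w\<in>W. l v w * g w) f"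
proof -
  interpret id: comm_ring_hom "\<lambda>x::'k. x" by (rule comm_ring_hom_id)
  interpret ev: comm_ring_hom "evaluate (\<lambda>x. x) g" by (rule id.evaluate_hom)
  show ?thesis
    unfolding linear_subst_def
    by (simp add: ev.hom_evaluate ev.hom_sum ev.hom_mult)
qed

text \<open>Chain rule. For a linear L, shifting after the substitution evaluates \<open>f\<close>
  at L(x) + L(y). In the Taylor expansion there, the coefficient of the outer monomial
  \<open>b\<close> in the power of L(y) with exponent \<open>a\<close> is a scalar, and it is zero
  unless the orders of \<open>a\<close> and \<open>b\<close> agree.\<close>

lemma hasse_deriv_linear_subst:
  fixes \<phi> :: "'a::comm_ring_1 \<Rightarrow> 'k::comm_ring_1" and l :: "'v \<Rightarrow> 'w \<Rightarrow> 'k"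
  assumes "comm_ring_hom \<phi>"
  shows "\<exists>\<kappa>. hasse_deriv b (linear_subst l W \<phi> f) =
    (\<Sum>a\<in>{a \<in> Poly_Mapping.keys (shift f). norm1 a = norm1 b}.
       scale (\<kappa> a) (linear_subst l W \<phi> (hasse_deriv a f)))"
proof -
  let ?L = "\<lambda>v. \<Sum>w\<in>W. Const (l v w) * Var w :: ('w, 'k) mpoly"
  let ?q = "\<lambda>v. \<Sum>w\<in>W. Const (Const (l v w)) * Var w :: ('w, ('w, 'k) mpoly) mpoly"
  let ?c = "\<lambda>c. Const (Const (\<phi> c)) :: ('w, ('w, 'k) mpoly) mpoly"
  have c: "comm_ring_hom ?c"
    by (rule comm_ring_hom_comp[OF Const_hom comm_ring_hom_comp[OF Const_hom assms]])
  have q: "monom_value ?q a \<in> outer_forms (norm1 a)" for a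
  proof (rule outer_forms_monom_value)
    fix v
    show "?q v \<in> outer_forms 1"
    proof (rule outer_forms_sum)
      fix w
      have eq: "Const (Const (l v w)) * Var w =
          Poly_Mapping.single (Poly_Mapping.single w 1) (Const (l v w))"
        by (simp add: Const_def[of "Const (l v w)"] Var_def mult_single)
      show "Const (Const (l v w)) * Var w \<in> outer_forms 1"
        unfolding eq by (auto simp: outer_forms_def lookup_single when_def zero_in_range_Const)
    qed
  qed
  then have "\<forall>a. \<exists>k. Poly_Mapping.lookup (monom_value ?q a) b = Const k"
    by (auto simp: outer_forms_def)
  then obtain \<kappa> where \<kappa>: "\<And>a. Poly_Mapping.lookup (monom_value ?q a) b = Const (\<kappa> a)"
    by metis
  have 0: "Poly_Mapping.lookup (monom_value ?q a) b = 0" if "norm1 a \<noteq> norm1 b" for a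
    using q[of a] that by (auto simp: outer_forms_def)
  have "shift (linear_subst l W \<phi> f) = evaluate ?c (\<lambda>v. Const (?L v) + ?q v) f"
    unfolding linear_subst_def
    by (simp add: shift.hom_evaluate shift_Const shift_Var shift.hom_sum shift.hom_mult
        Const.hom_sum Const.hom_mult distrib_left sum.distrib)
  also have "\<dots> = (\<Sum>a\<in>Poly_Mapping.keys (shift f).
      evaluate ?c (\<lambda>v. Const (?L v)) (hasse_deriv a f) * monom_value ?q a)"
    by (rule evaluate_hasse_expansion[OF c])
  also have "\<dots> = (\<Sum>a\<in>Poly_Mapping.keys (shift f).
      Const (linear_subst l W \<phi> (hasse_deriv a f)) * monom_value ?q a)"
    by (simp only: linear_subst_def Const.hom_evaluate)
  finally have "hasse_deriv b (linear_subst l W \<phi> f) = (\<Sum>a\<in>Poly_Mapping.keys (shift f).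
      linear_subst l W \<phi> (hasse_deriv a f) * Poly_Mapping.lookup (monom_value ?q a) b)"
    by (simp add: hasse_deriv_def lookup_sum)
  also have "\<dots> = (\<Sum>a\<in>{a \<in> Poly_Mapping.keys (shift f). norm1 a = norm1 b}.
       scale (\<kappa> a) (linear_subst l W \<phi> (hasse_deriv a f)))"
    using 0 \<kappa> by (intro sum.mono_neutral_cong_right) (auto simp: scale_def mult.commute)
  finally show ?thesis by blast
qed

section \<open>Independence of derivatives and bounds on dimensions\<close>

interpretation mpoly: vector_space "scale :: 'a::field \<Rightarrow> ('v, 'a) mpoly \<Rightarrow> _"
  by (rule vector_space_scale)

lemma lookup_scale [simp]: "Poly_Mapping.lookup (scale c f) a = c * Poly_Mapping.lookup f a"
  by (simp add: scale_def)

text \<open>Test a vanishing combination at the coefficient \<open>c p\<close>, where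
  \<open>p\<close> has least \<open>\<omega>\<close> among the indices with nonzero scalar: by
  triangularity only the term of \<open>p\<close> contributes there.\<close>

lemma card_le_of_triangular:
  fixes d :: "'p \<Rightarrow> ('v, 'k::field) mpoly" and \<omega> :: "'p \<Rightarrow> 'o::linorder"
  assumes "finite P" "finite B" and span: "\<And>p. p \<in> P \<Longrightarrow> d p \<in> mpoly.span B"
    and diag: "\<And>p. p \<in> P \<Longrightarrow> Poly_Mapping.lookup (d p) (c p) \<noteq> 0"
    and tri: "\<And>p q. p \<in> P \<Longrightarrow> q \<in> P \<Longrightarrow> Poly_Mapping.lookup (d q) (c p) \<noteq> 0 \<Longrightarrow> q = p \<or> \<omega> q < \<omega> p"
  shows "card P \<le> card B"
proof -
  \<comment> \<open>Independence concerns the set of vectors, which has as many elements as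
    \<open>P\<close> only if no two of them coincide.\<close>
  have inj: "inj_on d P"
  proof (rule inj_onI)
    fix p q assume "p \<in> P" "q \<in> P" "d p = d q"
    then have "q = p \<or> \<omega> q < \<omega> p" "p = q \<or> \<omega> p < \<omega> q"
      using diag[of p] diag[of q] tri[of p q] tri[of q p] by auto
    then show "p = q" by auto
  qed
  have "mpoly.independent (d ` P)"
  proof
    assume "mpoly.dependent (d ` P)"
    then obtain u where u: "\<exists>v\<in>d ` P. u v \<noteq> 0" "(\<Sum>v\<in>d ` P. scale (u v) v) = 0"
      using \<open>finite P\<close> by (auto simp: mpoly.dependent_finite)
    define S where "S = {p \<in> P. u (d p) \<noteq> 0}"
    have "finite S" "S \<noteq> {}" using u(1) \<open>finite P\<close> by (auto simp: S_def)
    then have "Min (\<omega> ` S) \<in> \<omega> ` S" by simp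
    then obtain p where p: "p \<in> S" "Min (\<omega> ` S) = \<omega> p" by blast
    have p_min: "\<omega> p \<le> \<omega> q" if "q \<in> S" for q
      using Min_le[of "\<omega> ` S" "\<omega> q"] that \<open>finite S\<close> p(2) by simp
    have "0 = (\<Sum>q\<in>P. u (d q) * Poly_Mapping.lookup (d q) (c p))"
      using arg_cong[OF u(2), of "\<lambda>h. Poly_Mapping.lookup h (c p)"]
      by (simp add: sum.reindex[OF inj] lookup_sum)
    also have "\<dots> = (\<Sum>q\<in>{p}. u (d q) * Poly_Mapping.lookup (d q) (c p))"
    proof (rule sum.mono_neutral_right)
      show "\<forall>q\<in>P - {p}. u (d q) * Poly_Mapping.lookup (d q) (c p) = 0"
      proof
        fix q assume q: "q \<in> P - {p}"
        show "u (d q) * Poly_Mapping.lookup (d q) (c p) = 0"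
        proof (rule ccontr)
          assume "\<not> ?thesis"
          then have "q \<in> S" "Poly_Mapping.lookup (d q) (c p) \<noteq> 0" using q by (auto simp: S_def)
          then have "\<omega> q < \<omega> p" using tri[of p q] p(1) q by (auto simp: S_def)
          with p_min[OF \<open>q \<in> S\<close>] show False by simp
        qed
      qed
    qed (use p \<open>finite P\<close> in \<open>auto simp: S_def\<close>)
    finally show False using p(1) diag[of p] by (auto simp: S_def)
  qed
  moreover have "d ` P \<subseteq> mpoly.span B" using span by auto
  ultimately have "card (d ` P) \<le> card B"
    using mpoly.independent_span_bound[OF \<open>finite B\<close>] by blast
  then show ?thesis by (simp add: card_image[OF inj])
qed

lemma keys_hasse_index:
  fixes f :: "('v, 'a::comm_ring_1) mpoly"
  assumes "\<forall>a\<in>Poly_Mapping.keys f. Poly_Mapping.keys a \<subseteq> V" "hasse_deriv a f \<noteq> 0"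
  shows "Poly_Mapping.keys a \<subseteq> V"
proof -
  from assms(2) obtain c where "Poly_Mapping.lookup (hasse_deriv a f) c \<noteq> 0"
    by (metis lookup_zero poly_mapping_eqI)
  then have "Poly_Mapping.lookup f (a + c) \<noteq> 0"
    by (auto simp: lookup_hasse_deriv)
  then have "Poly_Mapping.keys (a + c) \<subseteq> V"
    using assms(1) by (auto simp: in_keys_iff)
  then show ?thesis
    by (auto simp: in_keys_iff lookup_add subset_iff)
qed

lemma finite_hasse_derivs: "finite {hasse_deriv a f | a. P a}"
proof (rule finite_subset)
  show "{hasse_deriv a f | a. P a} \<subseteq> insert 0 ((\<lambda>a. hasse_deriv a f) ` Poly_Mapping.keys (shift f))"
    by (auto simp: hasse_deriv_def in_keys_iff)
qed simp

text \<open>Passage from the large field \<open>'k\<close> down to \<open>'a\<close>. By the chain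
  rule the derivatives of \<open>g\<close> lie in the \<open>'k\<close>-span of the substituted
  derivatives of \<open>f\<close>, and the image of an \<open>'a\<close>-basis already spans these.
  \<open>Q\<close> restricts the order of differentiation, which the chain rule preserves.\<close>

lemma card_le_dimension_hasse:
  fixes l :: "'v \<Rightarrow> 'w \<Rightarrow> 'k::field" and W :: "'w set"
    and f :: "('v, 'a::field) mpoly" and \<phi> :: "'a \<Rightarrow> 'k" and \<omega> :: "'p \<Rightarrow> 'o::linorder"
  assumes f: "\<forall>a\<in>Poly_Mapping.keys f. Poly_Mapping.keys a \<subseteq> V"
    and \<phi>: "comm_ring_hom \<phi>"
  defines "g \<equiv> linear_subst l W \<phi> f"
  assumes "finite P" and Q: "\<And>p. p \<in> P \<Longrightarrow> Q (norm1 (b p))"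
    and diag: "\<And>p. p \<in> P \<Longrightarrow> Poly_Mapping.lookup (hasse_deriv (b p) g) (c p) \<noteq> 0"
    and tri: "\<And>p q. p \<in> P \<Longrightarrow> q \<in> P \<Longrightarrow> Poly_Mapping.lookup (hasse_deriv (b q) g) (c p) \<noteq> 0 \<Longrightarrow>
      q = p \<or> \<omega> q < \<omega> p"
  shows "card P \<le> dimension (mpoly.span {hasse_deriv a f | a. Poly_Mapping.keys a \<subseteq> V \<and> Q (norm1 a)})"
proof -
  define D where "D = {hasse_deriv a f | a. Poly_Mapping.keys a \<subseteq> V \<and> Q (norm1 a)}"
  interpret \<phi>: comm_ring_hom \<phi> by fact
  interpret E: comm_ring_hom "linear_subst l W \<phi>" by (rule linear_subst_hom[OF \<phi>])
  have "finite D" unfolding D_def by (rule finite_hasse_derivs)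
  obtain B where B: "B \<subseteq> mpoly.span D" "mpoly.independent B" "mpoly.span D \<subseteq> mpoly.span B"
      "card B = dimension (mpoly.span D)"
    by (rule mpoly.basis_exists)
  have "finite B"
    using mpoly.independent_span_bound[OF \<open>finite D\<close> B(2,1)] by simp
  \<comment> \<open>The substitution is semilinear along \<open>\<phi>\<close>, so combinations over
    the small field become combinations over the large one.\<close>
  have E_span: "linear_subst l W \<phi> h \<in> mpoly.span (linear_subst l W \<phi> ` B)" if "h \<in> mpoly.span B" for h
    using that
  proof (induction rule: mpoly.span_induct_alt)
    case (step c x y)
    then have "linear_subst l W \<phi> x \<in> mpoly.span (linear_subst l W \<phi> ` B)"
      by (intro mpoly.span_base) simp
    with step show ?case
      by (simp add: E.hom_add linear_subst_scale[OF \<phi>] mpoly.span_add mpoly.span_scale)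
  qed (simp add: mpoly.span_zero)
  have "hasse_deriv (b p) g \<in> mpoly.span (linear_subst l W \<phi> ` B)" if "p \<in> P" for p
  proof -
    obtain \<kappa> where \<kappa>: "hasse_deriv (b p) g =
      (\<Sum>a\<in>{a \<in> Poly_Mapping.keys (shift f). norm1 a = norm1 (b p)}.
         scale (\<kappa> a) (linear_subst l W \<phi> (hasse_deriv a f)))"
      unfolding g_def using hasse_deriv_linear_subst[OF \<phi>] by blast
    show ?thesis
      unfolding \<kappa>
    proof (intro mpoly.span_sum mpoly.span_scale E_span)
      fix a assume a: "a \<in> {a \<in> Poly_Mapping.keys (shift f). norm1 a = norm1 (b p)}"
      then have "hasse_deriv a f \<noteq> 0" by (simp add: hasse_deriv_def in_keys_iff)
      then have "Poly_Mapping.keys a \<subseteq> V" by (rule keys_hasse_index[OF f])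
      moreover have "Q (norm1 a)" using a Q[OF that] by simp
      ultimately have "hasse_deriv a f \<in> D" by (auto simp: D_def)
      then show "hasse_deriv a f \<in> mpoly.span B" using B(3) mpoly.span_base by blast
    qed
  qed
  then have "card P \<le> card (linear_subst l W \<phi> ` B)"
    using \<open>finite P\<close> \<open>finite B\<close> diag tri
    by (intro card_le_of_triangular[where \<omega> = \<omega> and c = c and d = "\<lambda>p. hasse_deriv (b p) g"]) auto
  also have "\<dots> \<le> card B" by (rule card_image_le[OF \<open>finite B\<close>])
  finally show ?thesis using B(4) by (simp add: D_def)
qed

subsection \<open>Weights and dominant terms\<close>

definition weight :: "('v \<Rightarrow> int) \<Rightarrow> ('v \<Rightarrow>\<^sub>0 nat) \<Rightarrow> int" where
  "weight W m = (\<Sum>v\<in>Poly_Mapping.keys m. W v * int (Poly_Mapping.lookup m v))"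

lemma weight_superset:
  assumes "finite V" "Poly_Mapping.keys m \<subseteq> V"
  shows "weight W m = (\<Sum>v\<in>V. W v * int (Poly_Mapping.lookup m v))"
  unfolding weight_def using assms
  by (intro sum.mono_neutral_left) (auto simp: in_keys_iff)

lemma weight_add: "weight W (a + b) = weight W a + weight W b"
proof -
  let ?V = "Poly_Mapping.keys a \<union> Poly_Mapping.keys b"
  show ?thesis
    using weight_superset[of ?V a W] weight_superset[of ?V b W] weight_superset[of ?V "a + b" W]
      Poly_Mapping.keys_add[of a b]
    by (simp add: lookup_add distrib_left sum.distrib)
qed

lemma weight_combine: "weight (\<lambda>v. p * W v + W' v) m = p * weight W m + weight W' m"
  by (simp add: weight_def sum.distrib sum_distrib_left algebra_simps)

section \<open>Lexicographic combination of weights and separation by powers of an integer\<close>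

lemma obtain_maximizer:
  fixes w :: "'s \<Rightarrow> 'o::linorder"
  assumes "finite S" "S \<noteq> {}"
  obtains m where "m \<in> S" "\<And>m'. m' \<in> S \<Longrightarrow> w m' \<le> w m"
proof -
  have "Max (w ` S) \<in> w ` S" using assms by simp
  then obtain m where m: "m \<in> S" "Max (w ` S) = w m" by blast
  have "w m' \<le> w m" if "m' \<in> S" for m'
    using Max_ge[of "w ` S" "w m'"] that assms m(2) by simp
  with m that show ?thesis by blast
qed

text \<open>A gap in the integer function \<open>w\<close> is at least 1, so a factor exceeding
  every difference of values of \<open>v\<close> lets \<open>w\<close> decide first and
  \<open>v\<close> only break ties. Iteration gives lexicographic orders.\<close>

lemma exists_dominating_multiple:
  fixes w v :: "'s \<Rightarrow> int"
  assumes "finite S"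
  shows "\<exists>M\<ge>M0. \<forall>m\<in>S. \<forall>m'\<in>S. w m < w m' \<longrightarrow> M * w m + v m < M * w m' + v m'"
proof -
  define M where "M = \<bar>M0\<bar> + 1 + 2 * (\<Sum>m\<in>S. \<bar>v m\<bar>)"
  have "0 \<le> (\<Sum>m\<in>S. \<bar>v m\<bar>)"
    by (rule sum_nonneg) simp
  then have M: "0 \<le> M" "M0 \<le> M"
    unfolding M_def by linarith+
  have "M * w m + v m < M * w m' + v m'" if "m \<in> S" "m' \<in> S" "w m < w m'" for m m'
  proof -
    have "\<bar>v m\<bar> \<le> (\<Sum>m\<in>S. \<bar>v m\<bar>)" "\<bar>v m'\<bar> \<le> (\<Sum>m\<in>S. \<bar>v m\<bar>)"
      using that member_le_sum[of m S "\<lambda>m. \<bar>v m\<bar>"] member_le_sum[of m' S "\<lambda>m. \<bar>v m\<bar>"]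
        \<open>finite S\<close> by auto
    then have "v m - v m' < M" by (simp add: M_def)
    also have "M \<le> M * (w m' - w m)"
      using that(3) M(1) mult_left_mono[of 1 "w m' - w m" M] by simp
    finally show ?thesis by (simp add: algebra_simps)
  qed
  with M show ?thesis by blast
qed

text \<open>Distinct coefficient vectors are distinct polynomials in T. Their finitely many nonzero
  differences have finitely many roots, and any other nonnegative integer will do.\<close>

lemma exists_separating_base:
  fixes e :: "'s \<Rightarrow> nat \<Rightarrow> nat"
  assumes "finite S"
  shows "\<exists>T::int. 0 \<le> T \<and> (\<forall>m\<in>S. \<forall>m'\<in>S.
    (\<Sum>i<n. int (e m i) * T ^ i) = (\<Sum>i<n. int (e m' i) * T ^ i) \<longrightarrow> (\<forall>i<n. e m i = e m' i))"
proof -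
  define p where "p m = (\<Sum>i<n. Polynomial.monom (int (e m i)) i)" for m
  define R where "R = (\<Union>(m, m')\<in>{(m, m') \<in> S \<times> S. p m \<noteq> p m'}. {x. poly (p m - p m') x = 0})"
  have "finite {(m, m') \<in> S \<times> S. p m \<noteq> p m'}"
    using assms by (auto intro: finite_subset[of _ "S \<times> S"])
  then have "finite R"
    unfolding R_def by (rule finite_UN_I) (auto intro!: poly_roots_finite simp del: poly_diff)
  then have "infinite ({0..} - R)"
    by (simp add: infinite_Ici)
  then have "{0..} - R \<noteq> {}" by (intro notI) simp
  then obtain T where T: "T \<in> {0..} - R" by blast
  have "e m i = e m' i" if m: "m \<in> S" "m' \<in> S" "i < n"
    and eq: "(\<Sum>i<n. int (e m i) * T ^ i) = (\<Sum>i<n. int (e m' i) * T ^ i)" for m m' i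
  proof -
    have "poly (p m - p m') T = 0"
      using eq by (simp add: p_def poly_sum poly_monom)
    then have "p m = p m'" using T m by (auto simp: R_def)
    moreover have "coeff (p m) i = int (e m i)" for m
      using \<open>i < n\<close> by (simp add: p_def coeff_sum)
    ultimately show ?thesis by (metis of_nat_eq_iff)
  qed
  moreover have "0 \<le> T" using T by simp
  ultimately show ?thesis by blast
qed

text \<open>Number the variables and give each one a power of a separating \<open>T\<close>; the
  weight is then the exponent vector, read as a polynomial, evaluated at \<open>T\<close>.\<close>

lemma exists_injective_weight:
  assumes "finite S" "finite V" "\<forall>m\<in>S. Poly_Mapping.keys m \<subseteq> V"
  shows "\<exists>\<kappa>. (\<forall>v. 0 \<le> \<kappa> v) \<and> inj_on (weight \<kappa>) S"
proof -
  obtain h where h: "bij_betw h {..<card V} V"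
    using ex_bij_betw_nat_finite[OF \<open>finite V\<close>] by (auto simp: lessThan_atLeast0)
  define k where "k = inv_into {..<card V} h"
  have k: "k (h i) = i" if "i < card V" for i
    using that h by (simp add: k_def bij_betw_def inv_into_f_f)
  obtain T :: int where T: "0 \<le> T" "\<And>m m'. m \<in> S \<Longrightarrow> m' \<in> S \<Longrightarrow>
      (\<Sum>i<card V. int (Poly_Mapping.lookup m (h i)) * T ^ i) =
      (\<Sum>i<card V. int (Poly_Mapping.lookup m' (h i)) * T ^ i) \<Longrightarrow>
      \<forall>i<card V. Poly_Mapping.lookup m (h i) = Poly_Mapping.lookup m' (h i)"
    using exists_separating_base[OF \<open>finite S\<close>, of "\<lambda>m i. Poly_Mapping.lookup m (h i)" "card V"]
    by blast
  have w: "weight (\<lambda>v. T ^ k v) m = (\<Sum>i<card V. int (Poly_Mapping.lookup m (h i)) * T ^ i)"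
    if "m \<in> S" for m
  proof -
    have "weight (\<lambda>v. T ^ k v) m = (\<Sum>v\<in>V. T ^ k v * int (Poly_Mapping.lookup m v))"
      using assms that by (intro weight_superset) auto
    also have "\<dots> = (\<Sum>i<card V. T ^ k (h i) * int (Poly_Mapping.lookup m (h i)))"
      by (rule sum.reindex_bij_betw[OF h, symmetric])
    finally show ?thesis by (simp add: k mult.commute)
  qed
  have "inj_on (weight (\<lambda>v. T ^ k v)) S"
  proof (rule inj_onI)
    fix m m' assume m: "m \<in> S" "m' \<in> S" "weight (\<lambda>v. T ^ k v) m = weight (\<lambda>v. T ^ k v) m'"
    then have eq: "\<forall>i<card V. Poly_Mapping.lookup m (h i) = Poly_Mapping.lookup m' (h i)"
      using T(2)[OF m(1,2)] unfolding w[OF m(1), symmetric] w[OF m(2), symmetric] by blast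
    show "m = m'"
    proof (rule poly_mapping_eqI)
      fix v
      show "Poly_Mapping.lookup m v = Poly_Mapping.lookup m' v"
      proof (cases "v \<in> V")
        case True
        then obtain i where "i < card V" "v = h i" using h by (auto simp: bij_betw_def)
        then show ?thesis using eq by simp
      next
        case False
        then have "v \<notin> Poly_Mapping.keys m" "v \<notin> Poly_Mapping.keys m'" using assms(3) m by auto
        then show ?thesis by (simp add: in_keys_iff)
      qed
    qed
  qed
  with T(1) show ?thesis by (intro exI[of _ "\<lambda>v. T ^ k v"]) simp
qed

text \<open>A unique term of least order cannot cancel. Zero terms are a separate case because
  \<open>fls_subdegree 0\<close> is 0 by convention.\<close>

lemma dominant_fls_sum:
  fixes z :: "'s \<Rightarrow> 'k::field fls"
  assumes "finite S" "m0 \<in> S" "z m0 \<noteq> 0"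
    and "\<And>m. m \<in> S \<Longrightarrow> m \<noteq> m0 \<Longrightarrow> z m = 0 \<or> fls_subdegree (z m0) < fls_subdegree (z m)"
  shows "(\<Sum>m\<in>S. z m) \<noteq> 0" "fls_subdegree (\<Sum>m\<in>S. z m) = fls_subdegree (z m0)"
proof -
  have nth: "fls_nth (\<Sum>m\<in>S. z m) n = fls_nth (z m0) n" if "n \<le> fls_subdegree (z m0)" for n
  proof -
    have "fls_nth (z m) n = 0" if m: "m \<in> S - {m0}" for m
      using assms(4)[of m] m \<open>n \<le> _\<close> by auto
    then show ?thesis
      using sum.remove[OF assms(1,2), of "\<lambda>m. fls_nth (z m) n"] by (simp add: fls_nth_sum)
  qed
  show "fls_subdegree (\<Sum>m\<in>S. z m) = fls_subdegree (z m0)"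
    using assms(3) by (intro fls_subdegree_eqI) (simp_all add: nth)
  show "(\<Sum>m\<in>S. z m) \<noteq> 0"
    using nth[of "fls_subdegree (z m0)"] assms(3) by auto
qed

lemma fls_sum_subdegree_gt:
  fixes z :: "'s \<Rightarrow> 'k::field fls"
  assumes "\<And>m. m \<in> S \<Longrightarrow> z m = 0 \<or> n < fls_subdegree (z m)"
  shows "(\<Sum>m\<in>S. z m) = 0 \<or> n < fls_subdegree (\<Sum>m\<in>S. z m)"
proof (cases "(\<Sum>m\<in>S. z m) = 0")
  case False
  have "fls_nth (\<Sum>m\<in>S. z m) k = 0" if "k \<le> n" for k
    unfolding fls_nth_sum
  proof (rule sum.neutral, rule ballI)
    fix m assume "m \<in> S"
    then show "fls_nth (z m) k = 0" using assms[of m] \<open>k \<le> n\<close> by auto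
  qed
  with False show ?thesis by (intro disjI2 fls_subdegree_greaterI)
qed simp

lemma monom_value_nonzero:
  fixes X :: "'v \<Rightarrow> 'k::field fls"
  assumes "\<And>v. v \<in> Poly_Mapping.keys m \<Longrightarrow> X v \<noteq> 0"
  shows "monom_value X m \<noteq> 0"
    and "fls_subdegree (monom_value X m) =
      (\<Sum>v\<in>Poly_Mapping.keys m. int (Poly_Mapping.lookup m v) * fls_subdegree (X v))"
proof -
  have *: "(\<Prod>v\<in>V. X v ^ Poly_Mapping.lookup m v) \<noteq> 0 \<and>
      fls_subdegree (\<Prod>v\<in>V. X v ^ Poly_Mapping.lookup m v) =
      (\<Sum>v\<in>V. int (Poly_Mapping.lookup m v) * fls_subdegree (X v))"
    if "finite V" "V \<subseteq> Poly_Mapping.keys m" for V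
    using that
  proof (induction V)
    case (insert v V)
    then have "X v \<noteq> 0" using assms by auto
    with insert show ?case by (simp add: fls_subdegree_pow)
  qed simp
  show "monom_value X m \<noteq> 0" "fls_subdegree (monom_value X m) =
      (\<Sum>v\<in>Poly_Mapping.keys m. int (Poly_Mapping.lookup m v) * fls_subdegree (X v))"
    using *[OF finite_keys order_refl] by (simp_all add: monom_value_def)
qed

text \<open>Weights are negated orders, so that monomials of large weight are the dominant
  ones.\<close>

lemma monom_value_subdegree_ge:
  fixes X :: "'v \<Rightarrow> 'k::field fls"
  assumes "\<And>v. v \<in> Poly_Mapping.keys m \<Longrightarrow> X v = 0 \<or> - W v \<le> fls_subdegree (X v)"
  shows "monom_value X m = 0 \<or> - weight W m \<le> fls_subdegree (monom_value X m)"
proof (cases "\<exists>v\<in>Poly_Mapping.keys m. X v = 0")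
  case True
  then show ?thesis
    by (auto simp: monom_value_def in_keys_iff intro!: prod_zero)
next
  case False
  have "- weight W m \<le> (\<Sum>v\<in>Poly_Mapping.keys m.
      int (Poly_Mapping.lookup m v) * fls_subdegree (X v))"
    unfolding weight_def sum_negf[symmetric]
  proof (rule sum_mono)
    fix v assume "v \<in> Poly_Mapping.keys m"
    then have "- W v \<le> fls_subdegree (X v)" using assms False by blast
    then show "- (W v * int (Poly_Mapping.lookup m v)) \<le>
        int (Poly_Mapping.lookup m v) * fls_subdegree (X v)"
      using mult_left_mono[of "- W v" "fls_subdegree (X v)" "int (Poly_Mapping.lookup m v)"]
      by (simp add: mult.commute)
  qed
  with monom_value_nonzero(2)[of m X] False show ?thesis by auto
qed

lemma monom_value_subdegree_eq:
  fixes X :: "'v \<Rightarrow> 'k::field fls"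
  assumes "\<And>v. v \<in> Poly_Mapping.keys m \<Longrightarrow> X v \<noteq> 0 \<and> fls_subdegree (X v) = - W v"
  shows "monom_value X m \<noteq> 0" "fls_subdegree (monom_value X m) = - weight W m"
  using monom_value_nonzero[of m X] assms
  by (auto simp: weight_def sum_negf[symmetric] mult.commute intro!: sum.cong)

text \<open>Substituting powers of the Laurent variable along an injective weight gives the
  monomials of \<open>f\<close> distinct orders, so nothing cancels. Points over \<open>'a\<close>
  itself would not suffice: over a finite field a nonzero polynomial can vanish at all of
  them.\<close>

lemma monomial_point_nonzero:
  fixes f :: "('v, 'a::field) mpoly"
  assumes "f \<noteq> 0" "finite V" "\<forall>m\<in>Poly_Mapping.keys f. Poly_Mapping.keys m \<subseteq> V"
  shows "\<exists>X. evaluate fls_const X f \<noteq> 0"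
proof -
  let ?S = "Poly_Mapping.keys f"
  obtain \<kappa> where \<kappa>: "inj_on (weight \<kappa>) ?S"
    using exists_injective_weight[of ?S V] assms by auto
  define X :: "'v \<Rightarrow> 'a fls" where "X v = fls_X_intpow (- \<kappa> v)" for v
  have X: "monom_value X m \<noteq> 0" "fls_subdegree (monom_value X m) = - weight \<kappa> m" for m
    using monom_value_subdegree_eq[of m X \<kappa>] by (simp_all add: X_def fls_shift_eq0_iff)
  define z where "z m = fls_const (Poly_Mapping.lookup f m) * monom_value X m" for m
  have z: "z m \<noteq> 0 \<and> fls_subdegree (z m) = - weight \<kappa> m" if "m \<in> ?S" for m
    using that X[of m] by (auto simp: z_def in_keys_iff)
  have "?S \<noteq> {}"
    using \<open>f \<noteq> 0\<close> by (auto simp: poly_mapping_eq_iff in_keys_iff fun_eq_iff)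
  then obtain m0 where m0: "m0 \<in> ?S" "\<And>m. m \<in> ?S \<Longrightarrow> weight \<kappa> m \<le> weight \<kappa> m0"
    using obtain_maximizer[OF finite_keys] by metis
  have "(\<Sum>m\<in>?S. z m) \<noteq> 0"
  proof (rule dominant_fls_sum(1)[of _ m0])
    fix m assume "m \<in> ?S" "m \<noteq> m0"
    then have "weight \<kappa> m < weight \<kappa> m0"
      using m0(2)[OF \<open>m \<in> ?S\<close>] inj_onD[OF \<kappa> _ \<open>m \<in> ?S\<close> m0(1)] \<open>m \<noteq> m0\<close>
      by (metis order_le_less)
    then show "z m = 0 \<or> fls_subdegree (z m0) < fls_subdegree (z m)"
      using z[OF \<open>m \<in> ?S\<close>] z[OF m0(1)] by simp
  qed (use z[OF m0(1)] m0(1) in simp_all)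
  then have "evaluate fls_const X f \<noteq> 0" unfolding evaluate_altdef z_def .
  then show ?thesis by blast
qed

subsection \<open>Monomials of polynomials vanishing on singular matrices\<close>

definition row_sum :: "nat \<Rightarrow> (nat \<times> nat \<Rightarrow>\<^sub>0 nat) \<Rightarrow> nat \<Rightarrow> nat" where
  "row_sum N m i = (\<Sum>j<N. Poly_Mapping.lookup m (i, j))"

definition col_sum :: "nat \<Rightarrow> (nat \<times> nat \<Rightarrow>\<^sub>0 nat) \<Rightarrow> nat \<Rightarrow> nat" where
  "col_sum N m j = (\<Sum>i<N. Poly_Mapping.lookup m (i, j))"

lemma weight_margins:
  assumes "Poly_Mapping.keys m \<subseteq> {..<N} \<times> {..<N}"
  shows "weight (\<lambda>(i, j). \<alpha> i + \<mu> j) m =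
    (\<Sum>i<N. \<alpha> i * int (row_sum N m i)) + (\<Sum>j<N. \<mu> j * int (col_sum N m j))"
proof -
  have "weight (\<lambda>(i, j). \<alpha> i + \<mu> j) m =
      (\<Sum>(i, j)\<in>{..<N} \<times> {..<N}. \<alpha> i * int (Poly_Mapping.lookup m (i, j))) +
      (\<Sum>(i, j)\<in>{..<N} \<times> {..<N}. \<mu> j * int (Poly_Mapping.lookup m (i, j)))"
    using weight_superset[OF _ assms, of "\<lambda>(i, j). \<alpha> i + \<mu> j"]
    by (simp add: case_prod_unfold distrib_right sum.distrib)
  also have "(\<Sum>(i, j)\<in>{..<N} \<times> {..<N}. \<alpha> i * int (Poly_Mapping.lookup m (i, j))) =
      (\<Sum>i<N. \<alpha> i * int (row_sum N m i))"
    by (simp add: sum.cartesian_product[symmetric] row_sum_def sum_distrib_left)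
  also have "(\<Sum>(i, j)\<in>{..<N} \<times> {..<N}. \<mu> j * int (Poly_Mapping.lookup m (i, j))) =
      (\<Sum>i<N. \<Sum>j<N. \<mu> j * int (Poly_Mapping.lookup m (i, j)))"
    by (simp add: sum.cartesian_product[symmetric])
  also have "\<dots> = (\<Sum>j<N. \<mu> j * int (col_sum N m j))"
    by (subst sum.swap) (simp add: col_sum_def sum_distrib_left)
  finally show ?thesis .
qed

lemma sum_lessThan_add: "(\<Sum>i<n + k. h i) = (\<Sum>i<n. h i) + (\<Sum>i<k. h (n + i :: nat) :: 'a::comm_monoid_add)"
  by (induction k) (simp_all add: add_ac)

text \<open>By \<open>weight_margins\<close> the weight depends only on the row and column sums.
  Distinct powers of a separating \<open>T\<close> for all rows and columns make it determine
  them.\<close>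

lemma exists_margin_separating_weight:
  assumes "finite S" "\<And>m. m \<in> S \<Longrightarrow> Poly_Mapping.keys m \<subseteq> {..<N} \<times> {..<N}"
  obtains \<alpha> \<mu> :: "nat \<Rightarrow> int" where
    "\<And>m m'. m \<in> S \<Longrightarrow> m' \<in> S \<Longrightarrow>
      weight (\<lambda>(i, j). \<alpha> i + \<mu> j) m = weight (\<lambda>(i, j). \<alpha> i + \<mu> j) m' \<Longrightarrow>
      (\<forall>i<N. row_sum N m i = row_sum N m' i) \<and> (\<forall>j<N. col_sum N m j = col_sum N m' j)"
proof -
  define e where "e m i = (if i < N then row_sum N m i else col_sum N m (i - N))" for m i
  obtain T :: int where T: "\<And>m m'. m \<in> S \<Longrightarrow> m' \<in> S \<Longrightarrow>
      (\<Sum>i<N+N. int (e m i) * T ^ i) = (\<Sum>i<N+N. int (e m' i) * T ^ i) \<Longrightarrow>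
      \<forall>i<N+N. e m i = e m' i"
    using exists_separating_base[OF \<open>finite S\<close>, of e "N + N"] by blast
  have w: "weight (\<lambda>(i, j). T ^ i + T ^ (N + j)) m = (\<Sum>i<N+N. int (e m i) * T ^ i)"
    if "m \<in> S" for m
    unfolding weight_margins[OF assms(2)[OF that]] sum_lessThan_add
    by (simp add: e_def mult.commute)
  show ?thesis
  proof (rule that[of "\<lambda>i. T ^ i" "\<lambda>j. T ^ (N + j)"])
    fix m m' assume m: "m \<in> S" "m' \<in> S" "weight (\<lambda>(i, j). T ^ i + T ^ (N + j)) m =
      weight (\<lambda>(i, j). T ^ i + T ^ (N + j)) m'"
    have e: "e m i = e m' i" if "i < N + N" for i
      using T[OF m(1,2)] m(3) that unfolding w[OF m(1)] w[OF m(2)] by blast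
    show "(\<forall>i<N. row_sum N m i = row_sum N m' i) \<and> (\<forall>j<N. col_sum N m j = col_sum N m' j)"
    proof (intro conjI allI impI)
      fix i assume "i < N"
      then show "row_sum N m i = row_sum N m' i" using e[of i] by (simp add: e_def)
    next
      fix j assume "j < N"
      then show "col_sum N m j = col_sum N m' j" using e[of "N + j"] by (simp add: e_def)
    qed
  qed
qed

text \<open>
  Let \<open>s\<close> be the Laurent variable. The matrix constructed here agrees with \<open>s\<close> to the power
  \<open>- W (a, b)\<close> up to terms of higher order in \<open>s\<close>, except in position \<open>(q, \<pi> q)\<close>, where it is
  of strictly higher order; a dominant monomial therefore has to involve that position.
\<close>

lemma exists_singular_perturbation:
  fixes W :: "nat \<times> nat \<Rightarrow> int"
  assumes "finite A" "\<pi> permutes A" "q \<in> A"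
    and dom: "\<And>a r s. a \<in> A \<Longrightarrow> r \<in> A \<Longrightarrow> s \<in> A \<Longrightarrow> a \<noteq> r \<Longrightarrow> s \<noteq> \<pi> r \<Longrightarrow>
      W (a, \<pi> r) + W (r, s) < W (r, \<pi> r) + W (a, s)"
  obtains X :: "nat \<times> nat \<Rightarrow> 'k::field fls" and c where
    "\<And>a. a \<in> A \<Longrightarrow> X (a, \<pi> q) = (\<Sum>b\<in>A - {\<pi> q}. X (a, b) * c b)"
    "\<And>v. v \<in> A \<times> A \<Longrightarrow> v \<noteq> (q, \<pi> q) \<Longrightarrow> X v \<noteq> 0 \<and> fls_subdegree (X v) = - W v"
    "X (q, \<pi> q) = 0 \<or> - W (q, \<pi> q) < fls_subdegree (X (q, \<pi> q))"
proof -
  define x where "x w = (fls_X_intpow (- w) :: 'k fls)" for w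
  have x: "x w \<noteq> 0" "fls_subdegree (x w) = - w" for w
    by (simp_all add: x_def fls_shift_eq0_iff)
  have x_mult: "x w * x w' = x (w + w')" for w w'
    using fls_X_intpow_times_fls_X_intpow[of "- w" "- w'"] by (simp add: x_def add.commute)
  define \<rho> where "\<rho> = inv_into UNIV \<pi>"
  have \<rho>: "\<pi> (\<rho> b) = b" "\<rho> (\<pi> b) = b" for b
    using assms(2) by (simp_all add: \<rho>_def permutes_inverses)
  have \<rho>A: "\<rho> b \<in> A" if "b \<in> A" for b
    using permutes_in_image[OF permutes_inv[OF assms(2)]] that by (simp add: \<rho>_def)
  have \<pi>A: "\<pi> b \<in> A" if "b \<in> A" for b
    using permutes_in_image[OF assms(2)] that by simp
  define s where "s = \<pi> q"
  \<comment> \<open>The scalar of column \<open>b\<close> is tuned to row \<open>\<rho> b\<close>: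
    there the entry of column \<open>b\<close> times \<open>c b\<close> is exactly
    \<open>x (W (\<rho> b, s))\<close>, the leading term wanted in column \<open>s\<close>.\<close>
  define c where "c b = x (W (\<rho> b, s) - W (\<rho> b, b))" for b
  define t where "t a b = x (W (a, b) + W (\<rho> b, s) - W (\<rho> b, b))" for a b
  define X where "X v = (if snd v = s then (\<Sum>b\<in>A - {s}. t (fst v) b) else x (W v))" for v
  have t0: "t a b \<noteq> 0" for a b by (simp add: t_def x)
  \<comment> \<open>By \<open>dom\<close>, in every row other than \<open>\<rho> b\<close> the
    contribution of column \<open>b\<close> has too high an order to matter.\<close>
  have t: "- W (a, s) < fls_subdegree (t a b)" if "a \<in> A" "b \<in> A - {s}" "\<rho> b \<noteq> a" for a b
    using dom[of a "\<rho> b" s] that \<rho>A[of b] \<pi>A[OF \<open>q \<in> A\<close>] by (auto simp: t_def x \<rho> s_def)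
  show ?thesis
  proof (rule that[of X c])
    fix a assume "a \<in> A"
    show "X (a, \<pi> q) = (\<Sum>b\<in>A - {\<pi> q}. X (a, b) * c b)"
      by (auto simp: X_def c_def t_def x_mult s_def algebra_simps intro!: sum.cong)
  next
    fix v assume v: "v \<in> A \<times> A" "v \<noteq> (q, \<pi> q)"
    obtain a b where ab: "v = (a, b)" by (cases v)
    show "X v \<noteq> 0 \<and> fls_subdegree (X v) = - W v"
    proof (cases "b = s")
      case False
      then show ?thesis by (simp add: ab X_def x)
    next
      case True
      \<comment> \<open>Row \<open>a\<close> differs from \<open>q\<close>, so column
        \<open>\<pi> a\<close> is among the summands; it supplies the unique term of lowest
        order.\<close>
      then have a: "a \<in> A" "\<pi> a \<in> A - {s}"
        using v ab \<pi>A[of a] \<rho> by (auto simp: s_def) (metis \<rho>(2))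
      have ta: "fls_subdegree (t a (\<pi> a)) = - W (a, s)" by (simp add: t_def x \<rho>)
      have lower: "t a b = 0 \<or> fls_subdegree (t a (\<pi> a)) < fls_subdegree (t a b)"
        if b: "b \<in> A - {s}" "b \<noteq> \<pi> a" for b
      proof -
        have "\<rho> b \<noteq> a" using \<rho> b(2) by metis
        with t[OF a(1) b(1)] show ?thesis by (simp add: ta)
      qed
      note sum = dominant_fls_sum[of "A - {s}" "\<pi> a" "t a", OF finite_Diff[OF \<open>finite A\<close>] a(2) t0 lower]
      show ?thesis using True ta sum by (simp add: ab X_def)
    qed
  next
    \<comment> \<open>In row \<open>q\<close> the matching column is \<open>s\<close> itself, which
      the sum omits; only terms of higher order remain.\<close>
    have "(\<Sum>b\<in>A - {s}. t q b) = 0 \<or> - W (q, s) < fls_subdegree (\<Sum>b\<in>A - {s}. t q b)"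
    proof (rule fls_sum_subdegree_gt)
      fix b assume b: "b \<in> A - {s}"
      then have "\<rho> b \<noteq> q" using \<rho>(1)[of b] by (auto simp: s_def)
      with t[OF \<open>q \<in> A\<close> b] show "t q b = 0 \<or> - W (q, s) < fls_subdegree (t q b)" by simp
    qed
    then show "X (q, \<pi> q) = 0 \<or> - W (q, \<pi> q) < fls_subdegree (X (q, \<pi> q))"
      by (simp add: X_def s_def)
  qed
qed

text \<open>Singularity is expressed by explicit scalars for one column, the form that the perturbed
  matrix provides and that allows an inner index to be eliminated from a product.\<close>

definition vanishes_on_dependent_columns :: "nat set \<Rightarrow> (nat \<times> nat, 'k::comm_ring_1) mpoly \<Rightarrow> bool" where
  "vanishes_on_dependent_columns A g \<longleftrightarrow>
     (\<forall>X c. \<forall>q\<in>A. (\<forall>a\<in>A. X (a, q) = (\<Sum>b\<in>A - {q}. X (a, b) * c b)) \<longrightarrow>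
       evaluate (\<lambda>x. x) X g = 0)"

text \<open>Take a monomial \<open>m0\<close> dominant for a suitable weight. If it missed some
  position \<open>(q, \<pi> q)\<close>, a singular perturbation there would keep its leading order,
  while no other monomial could reach that order; so \<open>g\<close> would not vanish at a matrix
  with dependent columns.\<close>

lemma exists_transversal_monomial:
  fixes g :: "(nat \<times> nat, 'k::field fls) mpoly" and \<alpha> \<mu> :: "nat \<Rightarrow> int"
  assumes "finite A" "g \<noteq> 0"
    and keys: "\<And>m. m \<in> Poly_Mapping.keys g \<Longrightarrow> Poly_Mapping.keys m \<subseteq> A \<times> A"
    and sing: "vanishes_on_dependent_columns A g"
    and \<pi>: "\<pi> permutes A"
  defines "\<Omega> \<equiv> (\<lambda>(i, j). \<alpha> i + \<mu> j)"
  obtains m where "m \<in> Poly_Mapping.keys g" "\<And>i. i \<in> A \<Longrightarrow> Poly_Mapping.lookup m (i, \<pi> i) \<noteq> 0"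
    "\<And>m'. m' \<in> Poly_Mapping.keys g \<Longrightarrow> weight \<Omega> m' \<le> weight \<Omega> m"
proof -
  let ?S = "Poly_Mapping.keys g"
  \<comment> \<open>The coefficients of \<open>g\<close> are Laurent series and contribute orders of
    their own; \<open>M1\<close> below ranks them under \<open>\<kappa>\<close>.\<close>
  define v where "v m = - fls_subdegree (Poly_Mapping.lookup g m)" for m
  obtain \<kappa> where \<kappa>: "\<And>v. 0 \<le> \<kappa> v" "inj_on (weight \<kappa>) ?S"
    using exists_injective_weight[of ?S "A \<times> A"] keys \<open>finite A\<close> by (metis finite_SigmaI finite_keys)
  define \<delta> :: "nat \<times> nat \<Rightarrow> int" where "\<delta> = (\<lambda>(i, j). if j = \<pi> i then 1 else 0)"
  obtain M1 where M1: "1 \<le> M1" "\<And>m m'. m \<in> ?S \<Longrightarrow> m' \<in> ?S \<Longrightarrow> weight \<kappa> m < weight \<kappa> m' \<Longrightarrow>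
      M1 * weight \<kappa> m + v m < M1 * weight \<kappa> m' + v m'"
    using exists_dominating_multiple[of ?S 1 "weight \<kappa>" v] by auto
  \<comment> \<open>Besides ranking \<open>\<delta>\<close> above \<open>\<kappa>\<close>,
    \<open>M2\<close> exceeds the \<open>\<kappa>\<close> parts of any two entries together, as
    needed for \<open>dom\<close>.\<close>
  obtain M2 where M2: "1 + 2 * (M1 * (\<Sum>u\<in>A \<times> A. \<kappa> u)) \<le> M2"
      "\<And>m m'. m \<in> ?S \<Longrightarrow> m' \<in> ?S \<Longrightarrow> weight \<delta> m < weight \<delta> m' \<Longrightarrow>
      M2 * weight \<delta> m + (M1 * weight \<kappa> m + v m) < M2 * weight \<delta> m' + (M1 * weight \<kappa> m' + v m')"
    using exists_dominating_multiple[of ?S "1 + 2 * (M1 * (\<Sum>u\<in>A \<times> A. \<kappa> u))" "weight \<delta>"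
        "\<lambda>m. M1 * weight \<kappa> m + v m"] by auto
  obtain M3 where M3: "\<And>m m'. m \<in> ?S \<Longrightarrow> m' \<in> ?S \<Longrightarrow> weight \<Omega> m < weight \<Omega> m' \<Longrightarrow>
      M3 * weight \<Omega> m + (M2 * weight \<delta> m + (M1 * weight \<kappa> m + v m)) <
      M3 * weight \<Omega> m' + (M2 * weight \<delta> m' + (M1 * weight \<kappa> m' + v m'))"
    using exists_dominating_multiple[of ?S 1 "weight \<Omega>"
        "\<lambda>m. M2 * weight \<delta> m + (M1 * weight \<kappa> m + v m)"] by auto
  \<comment> \<open>\<Omega> dominates the choice of the monomial, then the positions \<open>(i, \<pi> i)\<close>; \<kappa> breaks ties, and the
    valuations \<open>v\<close> of the coefficients become irrelevant. As \<Omega> is a row weight plus a column weight,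
    it cancels from the inequality \<open>dom\<close> below.\<close>
  define W where "W u = M3 * \<Omega> u + (M2 * \<delta> u + M1 * \<kappa> u)" for u
  define \<Phi> where "\<Phi> m = weight W m + v m" for m
  have \<Phi>: "\<Phi> m = M3 * weight \<Omega> m + (M2 * weight \<delta> m + (M1 * weight \<kappa> m + v m))" for m
    unfolding \<Phi>_def W_def weight_combine
    using weight_combine[of M1 \<kappa> "\<lambda>_. 0" m] by (simp add: weight_def[of "\<lambda>_. 0"])
  have "?S \<noteq> {}"
    using \<open>g \<noteq> 0\<close> by (auto simp: poly_mapping_eq_iff in_keys_iff fun_eq_iff)
  then obtain m0 where m0: "m0 \<in> ?S" "\<And>m. m \<in> ?S \<Longrightarrow> \<Phi> m \<le> \<Phi> m0"
    using obtain_maximizer[OF finite_keys, of g \<Phi>] by blast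
  have max: "weight \<Omega> m \<le> weight \<Omega> m0" if "m \<in> ?S" for m
    using M3[OF m0(1) that] m0(2)[OF that] unfolding \<Phi> by linarith
  \<comment> \<open>A tie in \<open>\<Phi>\<close> forces ties level by level, down to
    \<open>\<kappa>\<close>, which is injective on the monomials.\<close>
  have strict: "\<Phi> m < \<Phi> m0" if "m \<in> ?S" "m \<noteq> m0" for m
  proof (rule ccontr)
    assume "\<not> \<Phi> m < \<Phi> m0"
    then have eq: "\<Phi> m = \<Phi> m0" using m0(2)[OF that(1)] by simp
    then have \<Omega>_eq: "weight \<Omega> m = weight \<Omega> m0"
      using M3[OF m0(1) that(1)] M3[OF that(1) m0(1)] unfolding \<Phi> by linarith
    then have "M2 * weight \<delta> m + (M1 * weight \<kappa> m + v m) =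
        M2 * weight \<delta> m0 + (M1 * weight \<kappa> m0 + v m0)"
      using eq unfolding \<Phi> by simp
    note eq = this
    have \<delta>_eq: "weight \<delta> m = weight \<delta> m0"
      using eq M2(2)[OF m0(1) that(1)] M2(2)[OF that(1) m0(1)] by linarith
    then have "M1 * weight \<kappa> m + v m = M1 * weight \<kappa> m0 + v m0"
      using eq by simp
    then have "weight \<kappa> m = weight \<kappa> m0"
      using M1(2)[OF m0(1) that(1)] M1(2)[OF that(1) m0(1)] by linarith
    then show False using \<kappa>(2) that m0(1) by (auto dest: inj_onD)
  qed
  have "Poly_Mapping.lookup m0 (q, \<pi> q) \<noteq> 0" if "q \<in> A" for q
  proof
    assume 0: "Poly_Mapping.lookup m0 (q, \<pi> q) = 0"
    \<comment> \<open>Both sides use the same rows and columns, so \<open>\<Omega>\<close> cancels.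
      The right side gains \<open>M2\<close> at \<open>(r, \<pi> r)\<close>, while neither entry on
      the left lies on the graph of \<open>\<pi>\<close>.\<close>
    have dom: "W (a, \<pi> r) + W (r, s) < W (r, \<pi> r) + W (a, s)"
      if "a \<in> A" "r \<in> A" "s \<in> A" "a \<noteq> r" "s \<noteq> \<pi> r" for a r s
    proof -
      have *: "M1 * \<kappa> u \<le> M1 * (\<Sum>u\<in>A \<times> A. \<kappa> u)" if "u \<in> A \<times> A" for u
        using that \<kappa>(1) \<open>finite A\<close> M1(1) by (intro mult_left_mono member_le_sum) auto
      have "\<pi> r \<in> A" using \<pi> \<open>r \<in> A\<close> by (simp add: permutes_in_image)
      then have "(a, \<pi> r) \<in> A \<times> A" "(r, s) \<in> A \<times> A" using that by auto
      from this[THEN *] have "M1 * \<kappa> (a, \<pi> r) + M1 * \<kappa> (r, s) < M2"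
        using M2(1) by linarith
      moreover have "0 \<le> M1 * \<kappa> (r, \<pi> r)" "0 \<le> M1 * \<kappa> (a, s)"
        using M1(1) \<kappa>(1) by auto
      moreover have "\<pi> a \<noteq> \<pi> r" using \<pi> \<open>a \<noteq> r\<close> by (simp add: permutes_inj inj_eq)
      moreover have "0 \<le> M2 * \<delta> (a, s)"
        using calculation(1) M1(1) \<kappa>(1) by (auto simp: \<delta>_def) (smt (verit) mult_nonneg_nonneg)
      ultimately show ?thesis
        using \<open>s \<noteq> \<pi> r\<close> by (simp add: W_def \<Omega>_def \<delta>_def algebra_simps)
    qed
    obtain X :: "nat \<times> nat \<Rightarrow> 'k fls" and c where X:
      "\<And>a. a \<in> A \<Longrightarrow> X (a, \<pi> q) = (\<Sum>b\<in>A - {\<pi> q}. X (a, b) * c b)"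
      "\<And>v. v \<in> A \<times> A \<Longrightarrow> v \<noteq> (q, \<pi> q) \<Longrightarrow> X v \<noteq> 0 \<and> fls_subdegree (X v) = - W v"
      "X (q, \<pi> q) = 0 \<or> - W (q, \<pi> q) < fls_subdegree (X (q, \<pi> q))"
      using exists_singular_perturbation[of A \<pi> q W, OF \<open>finite A\<close> \<pi> \<open>q \<in> A\<close> dom] by blast
    define z where "z m = Poly_Mapping.lookup g m * monom_value X m" for m
    have z_ge: "z m = 0 \<or> - \<Phi> m \<le> fls_subdegree (z m)" if m: "m \<in> ?S" for m
    proof -
      have "X u = 0 \<or> - W u \<le> fls_subdegree (X u)" if "u \<in> Poly_Mapping.keys m" for u
        using X(2)[of u] X(3) keys[OF m] that by (cases "u = (q, \<pi> q)") auto
      then have "monom_value X m = 0 \<or> - weight W m \<le> fls_subdegree (monom_value X m)"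
        by (rule monom_value_subdegree_ge)
      then show ?thesis
        using m by (cases "monom_value X m = 0") (auto simp: z_def \<Phi>_def v_def in_keys_iff)
    qed
    have Xm0: "X u \<noteq> 0 \<and> fls_subdegree (X u) = - W u" if "u \<in> Poly_Mapping.keys m0" for u
    proof (rule X(2))
      show "u \<in> A \<times> A" using keys[OF m0(1)] that by blast
      show "u \<noteq> (q, \<pi> q)" using that 0 by (auto simp: in_keys_iff)
    qed
    have z0: "z m0 \<noteq> 0" "fls_subdegree (z m0) = - \<Phi> m0"
      using m0(1) monom_value_subdegree_eq[of m0 X W, OF Xm0] by (auto simp: z_def \<Phi>_def v_def in_keys_iff)
    have "(\<Sum>m\<in>?S. z m) \<noteq> 0"
    proof (rule dominant_fls_sum(1)[of ?S m0 z, OF finite_keys m0(1) z0(1)])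
      fix m assume m: "m \<in> ?S" "m \<noteq> m0"
      show "z m = 0 \<or> fls_subdegree (z m0) < fls_subdegree (z m)"
        using z_ge[OF m(1)] strict[OF m] z0(2) by auto
    qed
    moreover have "evaluate (\<lambda>x. x) X g = 0"
      using sing X(1) permutes_in_image[OF \<pi>, of q] \<open>q \<in> A\<close>
      unfolding vanishes_on_dependent_columns_def by blast
    ultimately show False by (simp add: evaluate_altdef z_def)
  qed
  with m0(1) max show ?thesis by (intro that[of m0]) auto
qed

subsection \<open>Determinantal ideals and low rank matrices\<close>

lemma poly_ring_carrier_iff:
  "f \<in> carrier (poly_ring V) \<longleftrightarrow> (\<forall>m\<in>Poly_Mapping.keys f. Poly_Mapping.keys m \<subseteq> V)"
  by (simp add: poly_ring_def)

lemma poly_ring_closed: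
  fixes f g :: "('v, 'a::comm_ring_1) mpoly"
  shows "0 \<in> carrier (poly_ring V :: ('v, 'a) mpoly ring)"
    and "1 \<in> carrier (poly_ring V :: ('v, 'a) mpoly ring)"
    and "f \<in> carrier (poly_ring V) \<Longrightarrow> g \<in> carrier (poly_ring V) \<Longrightarrow> f + g \<in> carrier (poly_ring V)"
    and "f \<in> carrier (poly_ring V) \<Longrightarrow> g \<in> carrier (poly_ring V) \<Longrightarrow> f * g \<in> carrier (poly_ring V)"
proof -
  interpret cring "poly_ring V :: ('v, 'a) mpoly ring" by (rule cring_poly_ring)
  note [simp] = poly_ring_def
  show "0 \<in> carrier (poly_ring V :: ('v, 'a) mpoly ring)" using zero_closed by simp
  show "1 \<in> carrier (poly_ring V :: ('v, 'a) mpoly ring)" using one_closed by simp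
  show "f + g \<in> carrier (poly_ring V)" if "f \<in> carrier (poly_ring V)" "g \<in> carrier (poly_ring V)"
    using a_closed[OF that] by (simp del: mem_Collect_eq)
  show "f * g \<in> carrier (poly_ring V)" if "f \<in> carrier (poly_ring V)" "g \<in> carrier (poly_ring V)"
    using m_closed[OF that] by (simp del: mem_Collect_eq)
qed

lemma poly_ring_sum:
  assumes "\<And>i. i \<in> I \<Longrightarrow> f i \<in> carrier (poly_ring V :: ('v, 'a::comm_ring_1) mpoly ring)"
  shows "(\<Sum>i\<in>I. f i) \<in> carrier (poly_ring V)"
  using assms by (induction I rule: infinite_finite_induct) (auto intro: poly_ring_closed)

lemma poly_ring_prod:
  assumes "\<And>i. i \<in> I \<Longrightarrow> f i \<in> carrier (poly_ring V :: ('v, 'a::comm_ring_1) mpoly ring)"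
  shows "(\<Prod>i\<in>I. f i) \<in> carrier (poly_ring V)"
  using assms by (induction I rule: infinite_finite_induct) (auto intro: poly_ring_closed)

lemma poly_ring_power:
  "f \<in> carrier (poly_ring V :: ('v, 'a::comm_ring_1) mpoly ring) \<Longrightarrow> f ^ n \<in> carrier (poly_ring V)"
  by (induction n) (auto intro: poly_ring_closed)

lemma poly_ring_Const: "Const c \<in> carrier (poly_ring V :: ('v, 'a::comm_ring_1) mpoly ring)"
  by (simp add: poly_ring_carrier_iff Const_def)

lemma poly_ring_Var: "v \<in> V \<Longrightarrow> Var v \<in> carrier (poly_ring V :: ('v, 'a::comm_ring_1) mpoly ring)"
  by (simp add: poly_ring_carrier_iff Var_def)

lemma poly_ring_uminus:
  "f \<in> carrier (poly_ring V :: ('v, 'a::comm_ring_1) mpoly ring) \<Longrightarrow> - f \<in> carrier (poly_ring V)"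
  by (simp add: poly_ring_carrier_iff in_keys_iff)

lemma linear_subst_carrier: "linear_subst l W \<phi> f \<in> carrier (poly_ring W)"
  unfolding linear_subst_def evaluate_def
  by (intro poly_ring_sum poly_ring_prod poly_ring_power poly_ring_closed poly_ring_Const poly_ring_Var)

lemma poly_ring_det:
  assumes "A \<in> carrier_mat r r"
    and "\<And>i j. i < r \<Longrightarrow> j < r \<Longrightarrow> A $$ (i, j) \<in> carrier (poly_ring V :: ('v, 'a::comm_ring_1) mpoly ring)"
  shows "det A \<in> carrier (poly_ring V)"
  unfolding det_def'[OF assms(1)]
proof (intro poly_ring_sum poly_ring_closed poly_ring_prod)
  fix p assume "p \<in> {p. p permutes {0..<r}}"
  show "signof p \<in> carrier (poly_ring V :: ('v, 'a) mpoly ring)"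
    using poly_ring_closed(2)[of V] poly_ring_uminus[OF poly_ring_closed(2), of V]
    by (cases "evenperm p") (simp_all add: sign_def)
  fix i assume "i \<in> {0..<r}"
  then show "A $$ (i, p i) \<in> carrier (poly_ring V)"
    using \<open>p \<in> _\<close> permutes_in_image[of p "{0..<r}" i] by (intro assms(2)) auto
qed

text \<open>Write the matrix as a product of two square ones, the left factor padded by zero columns
  and hence singular. The extra rows of the right factor, where \<open>h\<close> is unspecified,
  meet only zeros.\<close>

lemma det_eq_0_low_rank:
  fixes u :: "nat \<Rightarrow> 'i \<Rightarrow> 'k::field" and v :: "'i \<Rightarrow> nat \<Rightarrow> 'k"
  assumes "finite A" "card A < r"
  shows "det (mat r r (\<lambda>(a, b). \<Sum>c\<in>A. u a c * v c b)) = 0"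
proof -
  obtain h where h: "bij_betw h {0..<card A} A"
    using ex_bij_betw_nat_finite[OF \<open>finite A\<close>] by blast
  define P where "P = mat r r (\<lambda>(a, t). if t < card A then u a (h t) else 0)"
  define Q where "Q = mat r r (\<lambda>(t, b). v (h t) b)"
  have PQ: "P \<in> carrier_mat r r" "Q \<in> carrier_mat r r" by (simp_all add: P_def Q_def)
  have "mat r r (\<lambda>(a, b). \<Sum>c\<in>A. u a c * v c b) = P * Q"
  proof (rule eq_matI)
    fix a b assume "a < dim_row (P * Q)" "b < dim_col (P * Q)"
    then have ab: "a < r" "b < r" by (simp_all add: P_def Q_def)
    have "(P * Q) $$ (a, b) = (\<Sum>t\<in>{0..<r}. (if t < card A then u a (h t) else 0) * v (h t) b)"
      using ab by (simp add: P_def Q_def scalar_prod_def)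
    also have "\<dots> = (\<Sum>t\<in>{0..<card A}. u a (h t) * v (h t) b)"
      using assms(2) by (intro sum.mono_neutral_cong_right) auto
    also have "\<dots> = (\<Sum>c\<in>A. u a c * v c b)"
      by (rule sum.reindex_bij_betw[OF h])
    finally show "mat r r (\<lambda>(a, b). \<Sum>c\<in>A. u a c * v c b) $$ (a, b) = (P * Q) $$ (a, b)"
      using ab by simp
  qed (simp_all add: P_def Q_def)
  moreover have "det P = 0"
    unfolding det_0_iff_vec_prod_zero_field[OF PQ(1)]
  proof (intro exI conjI)
    \<comment> \<open>With indices from 0, column \<open>card A\<close> is the first padded one, and
      it exists since \<open>card A < r\<close>.\<close>
    show "unit_vec r (card A) \<noteq> 0\<^sub>v r"
      using assms(2) by (metis index_unit_vec(1) index_zero_vec(1) zero_neq_one)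
    show "P *\<^sub>v unit_vec r (card A) = 0\<^sub>v r"
      using assms(2) by (intro eq_vecI) (simp_all add: P_def scalar_prod_right_unit)
  qed simp
  ultimately show ?thesis using det_mult[OF PQ] by simp
qed

lemma minors_generic_matE:
  fixes x :: "(nat \<times> nat, 'a::comm_ring_1) mpoly"
  assumes "x \<in> minors r (generic_mat n m)"
  obtains I J where "I \<subseteq> {..<n}" "card I = r" "J \<subseteq> {..<m}" "card J = r"
    "x = det (mat r r (\<lambda>(a, b). Var (pick I a, pick J b)))"
    "x \<in> carrier (poly_ring (mat_vars n m))"
proof -
  from assms obtain I J where x: "x = det (submatrix (generic_mat n m) I J)"
    and IJ: "I \<subseteq> {..<n}" "card I = r" "J \<subseteq> {..<m}" "card J = r"
    by (auto simp: minors_def generic_mat_def)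
  have sets: "{i. i < n \<and> i \<in> I} = I" "{j. j < m \<and> j \<in> J} = J" using IJ by auto
  have pick: "pick I a < n" "pick J a < m" if "a < r" for a
    using pick_in_set_le[of a I] pick_in_set_le[of a J] IJ that by auto
  have sub: "submatrix (generic_mat n m :: (nat \<times> nat, 'a) mpoly mat) I J =
      mat r r (\<lambda>(a, b). Var (pick I a, pick J b))"
    using pick by (intro eq_matI) (simp_all add: submatrix_def generic_mat_def sets IJ)
  have "x \<in> carrier (poly_ring (mat_vars n m))"
    unfolding x sub using pick
    by (intro poly_ring_det[of _ r]) (auto intro!: poly_ring_Var simp: mat_vars_def)
  with IJ x show ?thesis by (intro that) (simp_all only: sub)
qed

text \<open>A generated ideal is an intersection of ideals, and the whole ring is one of them
  because the minors lie in it.\<close>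

lemma det_ideal_carrier:
  fixes f :: "(nat \<times> nat, 'a::field) mpoly"
  assumes "f \<in> det_ideal n m r"
  shows "f \<in> carrier (poly_ring (mat_vars n m))"
proof -
  interpret R: cring "poly_ring (mat_vars n m) :: (nat \<times> nat, 'a) mpoly ring"
    by (rule cring_poly_ring)
  have "minors r (generic_mat n m) \<subseteq> carrier (poly_ring (mat_vars n m) :: (nat \<times> nat, 'a) mpoly ring)"
    by (blast elim: minors_generic_matE)
  then show ?thesis
    using assms R.oneideal unfolding det_ideal_def genideal_def by blast
qed

text \<open>The polynomials vanishing at \<open>G\<close> form an ideal, so it is enough that the
  generators vanish.\<close>

lemma det_ideal_kernel:
  fixes \<phi> :: "'a::field \<Rightarrow> 'b::comm_ring_1"
  assumes \<phi>: "comm_ring_hom \<phi>" and f: "f \<in> det_ideal n m r"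
    and 0: "\<And>I J. det (mat r r (\<lambda>(a, b). G (pick I a, pick J b))) = 0"
  shows "evaluate \<phi> G f = 0"
proof -
  let ?R = "poly_ring (mat_vars n m) :: (nat \<times> nat, 'a) mpoly ring"
  interpret \<phi>: comm_ring_hom \<phi> by fact
  interpret ev: comm_ring_hom "evaluate \<phi> G" by (rule \<phi>.evaluate_hom)
  interpret R: cring ?R by (rule cring_poly_ring)
  define Z where "Z = {f \<in> carrier ?R. evaluate \<phi> G f = 0}"
  have ops: "\<zero>\<^bsub>?R\<^esub> = 0" "x \<oplus>\<^bsub>?R\<^esub> y = x + y" "x \<otimes>\<^bsub>?R\<^esub> y = x * y" for x y
    by (simp_all add: poly_ring_def)
  have "ideal Z ?R"
  proof (rule idealI)
    show "ring ?R" by (rule R.ring_axioms)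
    show "subgroup Z (add_monoid ?R)"
    proof (rule group.subgroupI[OF R.a_group])
      fix x assume x: "x \<in> Z"
      then have "inv\<^bsub>add_monoid ?R\<^esub> x \<in> carrier ?R"
        using R.a_inv_closed[of x] by (simp add: Z_def a_inv_def)
      moreover have "inv\<^bsub>add_monoid ?R\<^esub> x = - x"
        using R.l_neg[of x] x by (simp add: Z_def a_inv_def ops eq_neg_iff_add_eq_0)
      ultimately show "inv\<^bsub>add_monoid ?R\<^esub> x \<in> Z"
        using x by (simp add: Z_def ev.hom_uminus)
    next
      show "Z \<noteq> {}" using poly_ring_closed(1) by (force simp: Z_def)
    qed (auto simp: Z_def ops poly_ring_closed ev.hom_add)
  qed (auto simp: Z_def ops poly_ring_closed ev.hom_mult)
  moreover have "minors r (generic_mat n m) \<subseteq> Z"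
  proof
    fix x :: "(nat \<times> nat, 'a) mpoly" assume "x \<in> minors r (generic_mat n m)"
    then obtain I J where x: "x = det (mat r r (\<lambda>(a, b). Var (pick I a, pick J b)))" "x \<in> carrier ?R"
      by (rule minors_generic_matE)
    have "evaluate \<phi> G x = det (map_mat (evaluate \<phi> G) (mat r r (\<lambda>(a, b). Var (pick I a, pick J b))))"
      unfolding x(1) by (rule ev.hom_det[symmetric])
    also have "map_mat (evaluate \<phi> G) (mat r r (\<lambda>(a, b). Var (pick I a, pick J b))) =
        mat r r (\<lambda>(a, b). G (pick I a, pick J b))"
      by (rule eq_matI) simp_all
    finally show "x \<in> Z" using x(2) 0 by (simp add: Z_def)
  qed
  ultimately have "f \<in> Z"
    using f by (auto simp: det_ideal_def genideal_def)
  then show ?thesis by (simp add: Z_def)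
qed

text \<open>Selecting rows and columns of a product keeps its inner dimension, so every minor of
  size \<open>r\<close> is zero.\<close>

lemma det_ideal_vanishes_low_rank:
  fixes f :: "(nat \<times> nat, 'a::field) mpoly" and \<phi> :: "'a \<Rightarrow> 'k::field"
  assumes "comm_ring_hom \<phi>" "f \<in> det_ideal n m r" "finite A" "card A < r"
  shows "evaluate \<phi> (\<lambda>(i, j). \<Sum>a\<in>A. U i a * V a j) f = 0"
proof (rule det_ideal_kernel[OF assms(1,2)])
  fix I J
  show "det (mat r r (\<lambda>(a, b). (\<lambda>(i, j). \<Sum>c\<in>A. U i c * V c j) (pick I a, pick J b))) = 0"
    using det_eq_0_low_rank[OF assms(3,4), of "\<lambda>a. U (pick I a)" "\<lambda>c b. V c (pick J b)"] by simp
qed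

subsection \<open>Reduction to square matrices and the lower bound\<close>

lemma evaluate_cong:
  assumes "f \<in> carrier (poly_ring V)" "\<And>v. v \<in> V \<Longrightarrow> g v = h v"
  shows "evaluate \<phi> g f = evaluate \<phi> h f"
  unfolding evaluate_def using assms
  by (intro sum.cong prod.cong refl arg_cong2[where f = "(*)"] arg_cong2[where f = "(^)"])
    (auto simp: poly_ring_carrier_iff)

section \<open>Pairs of index sets and exponents supported on graphs of permutations\<close>

lemma exists_permutation_image:
  assumes "finite A" "I \<subseteq> A" "J \<subseteq> A" "card I = card J"
  shows "\<exists>\<pi>. \<pi> permutes A \<and> \<pi> ` I = J"
proof -
  have fin: "finite I" "finite J" using assms by (auto intro: finite_subset)
  obtain f where f: "bij_betw f I J"
    using finite_same_card_bij[OF fin assms(4)] by blast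
  have "card (A - I) = card (A - J)"
    using assms fin by (simp add: card_Diff_subset)
  then obtain h where h: "bij_betw h (A - I) (A - J)"
    using finite_same_card_bij[of "A - I" "A - J"] \<open>finite A\<close> by blast
  define \<pi> where "\<pi> x = (if x \<in> I then f x else if x \<in> A then h x else x)" for x
  have "bij_betw \<pi> I J"
    using f by (subst bij_betw_cong[of _ _ f]) (auto simp: \<pi>_def)
  moreover have "bij_betw \<pi> (A - I) (A - J)"
    using h by (subst bij_betw_cong[of _ _ h]) (auto simp: \<pi>_def)
  ultimately have "bij_betw \<pi> (I \<union> (A - I)) (J \<union> (A - J))"
    by (rule bij_betw_combine) auto
  then have "bij_betw \<pi> A A"
    using assms(2,3) by (simp add: Un_absorb1)
  then have "\<pi> permutes A"
    by (rule bij_imp_permutes) (use assms(2) in \<open>auto simp: \<pi>_def\<close>)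
  then show ?thesis
    using \<open>bij_betw \<pi> I J\<close> by (auto simp: bij_betw_def)
qed

text \<open>\<open>Q\<close> selects the admissible sizes: all of them for the full space of
  derivatives, those up to \<open>d\<close> for derivatives of order at most
  \<open>d\<close>.\<close>

definition minor_indices :: "nat set \<Rightarrow> (nat \<Rightarrow> bool) \<Rightarrow> (nat set \<times> nat set) set" where
  "minor_indices A Q = {(I, J). I \<subseteq> A \<and> J \<subseteq> A \<and> card I = card J \<and> Q (card I)}"

lemma card_minor_indices:
  assumes "finite A"
  shows "finite (minor_indices A Q)"
    and "card (minor_indices A Q) = (\<Sum>i | i \<le> card A \<and> Q i. (card A choose i)\<^sup>2)"
proof -
  define P where "P i = {I. I \<subseteq> A \<and> card I = i}" for i
  have eq: "minor_indices A Q = (\<Union>i\<in>{i. i \<le> card A \<and> Q i}. P i \<times> P i)"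
    using card_mono[OF assms] by (auto simp: minor_indices_def P_def)
  have fin: "finite (P i)" for i
    using assms by (auto simp: P_def intro: finite_subset[of _ "Pow A"])
  show "finite (minor_indices A Q)" unfolding eq using fin by auto
  have "card (minor_indices A Q) = (\<Sum>i | i \<le> card A \<and> Q i. card (P i \<times> P i))"
    unfolding eq using fin by (intro card_UN_disjoint) (auto simp: P_def)
  also have "\<dots> = (\<Sum>i | i \<le> card A \<and> Q i. (card A choose i)\<^sup>2)"
    using n_subsets[OF assms] by (simp add: card_cartesian_product P_def power2_eq_square)
  finally show "card (minor_indices A Q) = (\<Sum>i | i \<le> card A \<and> Q i. (card A choose i)\<^sup>2)" .
qed

lemma sum_choose_squares_mono:
  assumes "r \<le> k"
  shows "(\<Sum>i | i \<le> r \<and> Q i. (r choose i)\<^sup>2) \<le> (\<Sum>i | i \<le> k \<and> Q i. (k choose i)\<^sup>2)"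
proof -
  have "(\<Sum>i | i \<le> r \<and> Q i. (r choose i)\<^sup>2) \<le> (\<Sum>i | i \<le> r \<and> Q i. (k choose i)\<^sup>2)"
    using assms by (intro sum_mono power_mono binomial_right_mono) auto
  also have "\<dots> \<le> (\<Sum>i | i \<le> k \<and> Q i. (k choose i)\<^sup>2)"
    using assms by (intro sum_mono2) auto
  finally show ?thesis .
qed

lemma row_sum_add: "row_sum N (a + b) i = row_sum N a i + row_sum N b i"
  by (simp add: row_sum_def lookup_add sum.distrib)

lemma col_sum_add: "col_sum N (a + b) j = col_sum N a j + col_sum N b j"
  by (simp add: col_sum_def lookup_add sum.distrib)

definition graph_exponent :: "(nat \<Rightarrow> nat) \<Rightarrow> nat set \<Rightarrow> (nat \<Rightarrow> nat) \<Rightarrow> (nat \<times> nat) \<Rightarrow>\<^sub>0 nat" where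
  "graph_exponent \<pi> I e = (\<Sum>i\<in>I. Poly_Mapping.single (i, \<pi> i) (e i))"

lemma lookup_graph_exponent:
  assumes "finite I"
  shows "Poly_Mapping.lookup (graph_exponent \<pi> I e) (i, j) = (if i \<in> I \<and> j = \<pi> i then e i else 0)"
proof -
  have "Poly_Mapping.lookup (graph_exponent \<pi> I e) (i, j) =
      (\<Sum>x\<in>I. if x = i then (if j = \<pi> i then e i else 0) else 0)"
    unfolding graph_exponent_def lookup_sum
    by (intro sum.cong) (auto simp: lookup_single when_def)
  then show ?thesis using assms by simp
qed

lemma norm1_graph_exponent: "norm1 (graph_exponent \<pi> I e) = (\<Sum>i\<in>I. e i)"
proof -
  have "norm1 (\<Sum>i\<in>I. h i) = (\<Sum>i\<in>I. norm1 (h i))" for h :: "nat \<Rightarrow> (nat \<times> nat) \<Rightarrow>\<^sub>0 nat"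
    by (induction I rule: infinite_finite_induct) (simp_all add: norm1_add)
  then show ?thesis by (simp add: graph_exponent_def)
qed

text \<open>The supports of the row and column sums recover \<open>I\<close> and its image, so
  margins distinguish the derivatives of different index pairs.\<close>

lemma row_sum_graph_exponent:
  assumes "finite I" "\<pi> permutes A" "I \<subseteq> A" "A \<subseteq> {..<N}" "\<And>i. i \<in> I \<Longrightarrow> e i \<noteq> 0"
  shows "row_sum N (graph_exponent \<pi> I e) i \<noteq> 0 \<longleftrightarrow> i \<in> I"
proof -
  have "\<pi> i < N" if "i \<in> I" for i
    using permutes_in_image[OF assms(2), of i] that assms(3,4) by auto
  then show ?thesis
    using assms(5) by (auto simp: row_sum_def lookup_graph_exponent[OF assms(1)])
qed

lemma col_sum_graph_exponent:
  assumes "finite I" "I \<subseteq> A" "A \<subseteq> {..<N}" "\<And>i. i \<in> I \<Longrightarrow> e i \<noteq> 0"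
  shows "col_sum N (graph_exponent \<pi> I e) j \<noteq> 0 \<longleftrightarrow> j \<in> \<pi> ` I"
  using assms by (auto simp: col_sum_def lookup_graph_exponent[OF assms(1)])

section \<open>Reduction to a square matrix of minimal size\<close>

lemma fls_const_hom: "comm_ring_hom (fls_const :: 'a::comm_ring_1 \<Rightarrow> 'a fls)"
  by unfold_locales (simp_all flip: fls_plus_const)

text \<open>\<open>A\<close> is a smallest set of inner indices admitting a product at which
  \<open>f\<close> is nonzero. The full set \<open>{..<n}\<close> admits one, by multiplying a
  nonzero point by the identity; vanishing at low rank gives the bound by \<open>r\<close>.\<close>

lemma minimal_factor_set:
  fixes f :: "(nat \<times> nat, 'a::field) mpoly"
  assumes f: "f \<in> det_ideal n m r" "f \<noteq> 0"
  obtains A and U V :: "nat \<Rightarrow> nat \<Rightarrow> 'a fls" where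
    "A \<subseteq> {..<n}" "r \<le> card A"
    "evaluate fls_const (\<lambda>(i, j). \<Sum>a\<in>A. U i a * V a j) f \<noteq> 0"
    "\<And>q U V :: nat \<Rightarrow> nat \<Rightarrow> 'a fls. q \<in> A \<Longrightarrow>
      evaluate fls_const (\<lambda>(i, j). \<Sum>a\<in>A - {q}. U i a * V a j) f = 0"
proof -
  define ev where "ev A U V = evaluate fls_const (\<lambda>(i, j). \<Sum>a\<in>A. U i a * V a j) f"
    for A and U V :: "nat \<Rightarrow> nat \<Rightarrow> 'a fls"
  have carrier: "f \<in> carrier (poly_ring (mat_vars n m))"
    by (rule det_ideal_carrier[OF f(1)])
  obtain X where X: "evaluate fls_const X f \<noteq> 0"
    using monomial_point_nonzero[OF f(2), of "mat_vars n m"] carrier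
    by (auto simp: poly_ring_carrier_iff mat_vars_def)
  let ?U = "\<lambda>i a. if a = i then 1 else 0"
  have "ev {..<n} ?U (\<lambda>a j. X (a, j)) = evaluate fls_const X f"
    unfolding ev_def
    by (rule evaluate_cong[OF carrier]) (auto simp: mat_vars_def if_distrib[of "\<lambda>x. x * _"] cong: if_cong)
  with X have "ev {..<n} ?U (\<lambda>a j. X (a, j)) \<noteq> 0" by simp
  moreover define R where "R A \<longleftrightarrow> A \<subseteq> {..<n} \<and> (\<exists>U V. ev A U V \<noteq> 0)" for A
  ultimately have "R {..<n}" by blast
  from ex_has_least_nat[of R, OF this, of card] obtain A
    where "R A" and least: "\<And>B. R B \<Longrightarrow> card A \<le> card B" by blast
  then have A: "A \<subseteq> {..<n}" "\<exists>U V. ev A U V \<noteq> 0" by (simp_all only: R_def)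
  have "finite A" using A(1) finite_subset by blast
  obtain U V where UV: "ev A U V \<noteq> 0" using A(2) by blast
  have "r \<le> card A"
    using det_ideal_vanishes_low_rank[OF fls_const_hom f(1) \<open>finite A\<close>, of U V] UV by (auto simp: ev_def not_le[symmetric])
  moreover have "ev (A - {q}) U V = 0" if "q \<in> A" for q U V
  proof (rule ccontr)
    assume "ev (A - {q}) U V \<noteq> 0"
    then have "card A \<le> card (A - {q})" using A(1) unfolding R_def by (intro least[unfolded R_def]) blast
    then show False using card_Diff1_less[OF \<open>finite A\<close> that] by simp
  qed
  ultimately show ?thesis
    using that[of A U V] A(1) UV by (simp add: ev_def)
qed

text \<open>Insert a square matrix X between \<open>U\<close> and \<open>V\<close>. At the identity
  this gives the nonzero value of \<open>f\<close> at U V. If the columns of X are dependent, one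
  inner index can be eliminated, and \<open>f\<close> vanishes by minimality of
  \<open>A\<close>.\<close>

lemma square_reduction:
  fixes f :: "(nat \<times> nat, 'a::field) mpoly"
  assumes f: "f \<in> det_ideal n m r" "f \<noteq> 0"
  obtains A and l :: "nat \<times> nat \<Rightarrow> nat \<times> nat \<Rightarrow> 'a fls" where
    "A \<subseteq> {..<n}" "r \<le> card A" "linear_subst l (A \<times> A) fls_const f \<noteq> 0"
    "vanishes_on_dependent_columns A (linear_subst l (A \<times> A) fls_const f)"
proof -
  obtain A and U V :: "nat \<Rightarrow> nat \<Rightarrow> 'a fls" where A: "A \<subseteq> {..<n}" "r \<le> card A"
    and UV: "evaluate fls_const (\<lambda>(i, j). \<Sum>a\<in>A. U i a * V a j) f \<noteq> 0"
    and min: "\<And>q U V :: nat \<Rightarrow> nat \<Rightarrow> 'a fls. q \<in> A \<Longrightarrow>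
      evaluate fls_const (\<lambda>(i, j). \<Sum>a\<in>A - {q}. U i a * V a j) f = 0"
    using minimal_factor_set[OF f] by blast
  have "finite A" using A(1) finite_subset by blast
  \<comment> \<open>The coefficient of entry (a, b) of X in entry (i, j) of U X V.\<close>
  define l where "l = (\<lambda>(i, j) (a, b). U i a * V b j)"
  define g where "g = linear_subst l (A \<times> A) fls_const f"
  have ev: "evaluate (\<lambda>x. x) X g =
      evaluate fls_const (\<lambda>(i, j). \<Sum>b\<in>A. (\<Sum>a\<in>A. U i a * X (a, b)) * V b j) f" for X
  proof -
    have "(\<Sum>w\<in>A \<times> A. l (i, j) w * X w) = (\<Sum>b\<in>A. (\<Sum>a\<in>A. U i a * X (a, b)) * V b j)" for i j
    proof -
      have "(\<Sum>w\<in>A \<times> A. l (i, j) w * X w) = (\<Sum>a\<in>A. \<Sum>b\<in>A. U i a * V b j * X (a, b))"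
        by (simp add: sum.cartesian_product l_def case_prod_unfold)
      also have "\<dots> = (\<Sum>b\<in>A. \<Sum>a\<in>A. U i a * V b j * X (a, b))"
        by (rule sum.swap)
      also have "\<dots> = (\<Sum>b\<in>A. (\<Sum>a\<in>A. U i a * X (a, b)) * V b j)"
        by (simp add: sum_distrib_left sum_distrib_right mult_ac)
      finally show ?thesis .
    qed
    then have "(\<Sum>w\<in>A \<times> A. l v w * X w) =
        (case v of (i, j) \<Rightarrow> \<Sum>b\<in>A. (\<Sum>a\<in>A. U i a * X (a, b)) * V b j)" for v
      by (cases v) (simp only: prod.case)
    then show ?thesis
      unfolding g_def by (simp only: evaluate_linear_subst[OF fls_const_hom])
  qed
  have "evaluate (\<lambda>x. x) (\<lambda>(a, b). if a = b then 1 else 0) g =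
      evaluate fls_const (\<lambda>(i, j). \<Sum>a\<in>A. U i a * V a j) f"
    unfolding ev using \<open>finite A\<close> by (simp add: if_distrib cong: if_cong sum.cong)
  then have "g \<noteq> 0"
    using UV by (auto simp: evaluate_def)
  moreover have "evaluate (\<lambda>x. x) X g = 0"
    if q: "q \<in> A" and X: "\<And>a. a \<in> A \<Longrightarrow> X (a, q) = (\<Sum>b\<in>A - {q}. X (a, b) * c b)" for X c q
  proof -
    define U' where "U' i b = (\<Sum>a\<in>A. U i a * X (a, b))" for i b
    define V' where "V' b j = V b j + c b * V q j" for b j
    have "(\<Sum>b\<in>A. U' i b * V b j) = (\<Sum>b\<in>A - {q}. U' i b * V' b j)" for i j
    proof -
      have "U' i q = (\<Sum>a\<in>A. \<Sum>b\<in>A - {q}. U i a * X (a, b) * c b)"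
        by (simp add: U'_def X sum_distrib_left mult.assoc)
      also have "\<dots> = (\<Sum>b\<in>A - {q}. \<Sum>a\<in>A. U i a * X (a, b) * c b)"
        by (rule sum.swap)
      also have "\<dots> = (\<Sum>b\<in>A - {q}. U' i b * c b)"
        by (simp add: U'_def sum_distrib_right)
      finally have "U' i q * V q j = (\<Sum>b\<in>A - {q}. U' i b * c b * V q j)"
        by (simp add: sum_distrib_right)
      then show ?thesis
        using sum.remove[OF \<open>finite A\<close> q, of "\<lambda>b. U' i b * V b j"]
        by (simp add: V'_def distrib_left sum.distrib mult.assoc)
    qed
    then show ?thesis
      unfolding ev U'_def[symmetric] using min[OF q, of U' V'] by simp
  qed
  ultimately show ?thesis
    using that[OF A] unfolding g_def vanishes_on_dependent_columns_def by blast
qed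

text \<open>For an index pair \<open>p\<close>, differentiate along a part \<open>b p\<close> of a
  transversal monomial and test at the remaining part \<open>c p\<close>. As the monomial has
  maximal weight, no \<open>b q\<close> heavier than \<open>b p\<close> can complete
  \<open>c p\<close> to a monomial of \<open>g\<close>.\<close>

lemma hasse_triangular_family:
  fixes g :: "(nat \<times> nat, 'k::field fls) mpoly"
  assumes A: "A \<subseteq> {..<N}" and "g \<noteq> 0" and g: "g \<in> carrier (poly_ring (A \<times> A))"
    and sing: "vanishes_on_dependent_columns A g"
    and Q: "CHAR('k) = 0 \<or> (\<forall>n. Q n)"
  obtains b c and \<omega> :: "nat set \<times> nat set \<Rightarrow> int" where
    "\<And>p. p \<in> minor_indices A Q \<Longrightarrow> Q (norm1 (b p))"
    "\<And>p. p \<in> minor_indices A Q \<Longrightarrow> Poly_Mapping.lookup (hasse_deriv (b p) g) (c p) \<noteq> 0"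
    "\<And>p q. p \<in> minor_indices A Q \<Longrightarrow> q \<in> minor_indices A Q \<Longrightarrow>
      Poly_Mapping.lookup (hasse_deriv (b q) g) (c p) \<noteq> 0 \<Longrightarrow> q = p \<or> \<omega> q < \<omega> p"
proof -
  let ?P = "minor_indices A Q"
  have "finite A" using A finite_subset by blast
  have keys: "Poly_Mapping.keys m \<subseteq> A \<times> A" if "m \<in> Poly_Mapping.keys g" for m
    using g that by (auto simp: poly_ring_carrier_iff)
  have keysN: "Poly_Mapping.keys m \<subseteq> {..<N} \<times> {..<N}" if "m \<in> Poly_Mapping.keys g" for m
    using keys[OF that] A by blast
  \<comment> \<open>This weight is fixed once for all permutations, so the monomials
    \<open>M p\<close> below share its maximum and thus all their margins.\<close>
  obtain \<alpha> \<mu> :: "nat \<Rightarrow> int" where sep: "\<And>m m'. m \<in> Poly_Mapping.keys g \<Longrightarrow> m' \<in> Poly_Mapping.keys g \<Longrightarrow>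
      weight (\<lambda>(i, j). \<alpha> i + \<mu> j) m = weight (\<lambda>(i, j). \<alpha> i + \<mu> j) m' \<Longrightarrow>
      (\<forall>i<N. row_sum N m i = row_sum N m' i) \<and> (\<forall>j<N. col_sum N m j = col_sum N m' j)"
    using exists_margin_separating_weight[OF finite_keys keysN] by blast
  define w where "w = weight (\<lambda>(i, j). \<alpha> i + \<mu> j)"
  have w_add: "w (x + y) = w x + w y" for x y by (simp add: w_def weight_add)
  have "\<exists>\<pi>. \<pi> permutes A \<and> \<pi> ` fst p = snd p" if "p \<in> ?P" for p
    using that exists_permutation_image[OF \<open>finite A\<close>, of "fst p" "snd p"]
    by (auto simp: minor_indices_def)
  then obtain \<pi> where \<pi>: "\<And>p. p \<in> ?P \<Longrightarrow> \<pi> p permutes A" "\<And>p. p \<in> ?P \<Longrightarrow> \<pi> p ` fst p = snd p"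
    by metis
  have "\<exists>m. m \<in> Poly_Mapping.keys g \<and> (\<forall>i\<in>A. Poly_Mapping.lookup m (i, \<pi> p i) \<noteq> 0) \<and>
      (\<forall>m'\<in>Poly_Mapping.keys g. w m' \<le> w m)" if "p \<in> ?P" for p
    unfolding w_def
    using exists_transversal_monomial[where \<alpha> = \<alpha> and \<mu> = \<mu>,
        OF \<open>finite A\<close> \<open>g \<noteq> 0\<close> keys sing \<pi>(1)[OF that]] by metis
  then obtain M where M: "\<And>p. p \<in> ?P \<Longrightarrow> M p \<in> Poly_Mapping.keys g"
      "\<And>p i. p \<in> ?P \<Longrightarrow> i \<in> A \<Longrightarrow> Poly_Mapping.lookup (M p) (i, \<pi> p i) \<noteq> 0"
      "\<And>p m'. p \<in> ?P \<Longrightarrow> m' \<in> Poly_Mapping.keys g \<Longrightarrow> w m' \<le> w (M p)"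
    by metis
  \<comment> \<open>Exponent 1 keeps the order of the derivative equal to the size of the minor, but the binomial
    coefficients are then nonzero only in characteristic 0; removing the full power of a variable
    makes them 1.\<close>
  define e where "e p i = (if CHAR('k) = 0 then 1 else Poly_Mapping.lookup (M p) (i, \<pi> p i))" for p i
  define b where "b p = graph_exponent (\<pi> p) (fst p) (e p)" for p
  define c where "c p = M p - b p" for p
  have fst_A: "fst p \<subseteq> A" "finite (fst p)" if "p \<in> ?P" for p
    using that finite_subset[OF _ \<open>finite A\<close>] by (auto simp: minor_indices_def)
  have e: "e p i \<noteq> 0" "e p i \<le> Poly_Mapping.lookup (M p) (i, \<pi> p i)" if "p \<in> ?P" "i \<in> fst p" for p i
    using M(2)[OF that(1), of i] fst_A[OF that(1)] that(2) by (auto simp: e_def Suc_le_eq)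
  have b: "Poly_Mapping.lookup (b p) (i, j) = (if i \<in> fst p \<and> j = \<pi> p i then e p i else 0)"
    if "p \<in> ?P" for p i j
    unfolding b_def by (rule lookup_graph_exponent[OF fst_A(2)[OF that]])
  have bc: "b p + c p = M p" if "p \<in> ?P" for p
  proof (rule poly_mapping_eqI)
    fix v :: "nat \<times> nat"
    show "Poly_Mapping.lookup (b p + c p) v = Poly_Mapping.lookup (M p) v"
      using e[OF that] b[OF that] by (cases v) (auto simp: lookup_add c_def lookup_minus)
  qed
  have row: "row_sum N (b p) i \<noteq> 0 \<longleftrightarrow> i \<in> fst p" if "p \<in> ?P" for p i
    unfolding b_def by (rule row_sum_graph_exponent[OF _ \<pi>(1) _ A]) (use that fst_A e in auto)
  have col: "col_sum N (b p) j \<noteq> 0 \<longleftrightarrow> j \<in> snd p" if "p \<in> ?P" for p j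
    unfolding b_def \<pi>(2)[OF that, symmetric]
    by (rule col_sum_graph_exponent[OF _ _ A]) (use that fst_A e in auto)
  show ?thesis
  proof (rule that[of b c "\<lambda>p. w (b p)"])
    fix p assume p: "p \<in> ?P"
    \<comment> \<open>In characteristic 0 the order of \<open>b p\<close> is the size of the index
      sets; otherwise \<open>Q\<close> holds everywhere.\<close>
    show "Q (norm1 (b p))"
      using Q p by (auto simp: b_def norm1_graph_exponent e_def minor_indices_def)
    have "(of_nat (exponent_binomial (b p) (c p)) :: 'k fls) \<noteq> 0"
    proof (cases "CHAR('k) = 0")
      case True
      have "exponent_binomial (b p) (c p) \<noteq> 0"
        by (simp add: exponent_binomial_def)
      then show ?thesis using True by (simp add: of_nat_eq_0_iff_char_dvd)
    next
      case False
      have "exponent_binomial (b p) (c p) = 1"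
        unfolding exponent_binomial_def
      proof (rule prod.neutral, rule ballI)
        fix v assume "v \<in> Poly_Mapping.keys (b p)"
        then have "Poly_Mapping.lookup (b p) v \<noteq> 0" by (simp add: in_keys_iff)
        then have "Poly_Mapping.lookup (b p) v = Poly_Mapping.lookup (M p) v"
          using b[OF p] False by (cases v) (auto simp: e_def split: if_splits)
        then have "Poly_Mapping.lookup (c p) v = 0" by (simp add: c_def lookup_minus)
        then show "(Poly_Mapping.lookup (b p) v + Poly_Mapping.lookup (c p) v choose
            Poly_Mapping.lookup (b p) v) = 1" by simp
      qed
      then show ?thesis by simp
    qed
    then show "Poly_Mapping.lookup (hasse_deriv (b p) g) (c p) \<noteq> 0"
      using M(1)[OF p] by (simp add: lookup_hasse_deriv bc[OF p] in_keys_iff)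
  next
    fix p q assume p: "p \<in> ?P" and q: "q \<in> ?P"
      and nz: "Poly_Mapping.lookup (hasse_deriv (b q) g) (c p) \<noteq> 0"
    then have key: "b q + c p \<in> Poly_Mapping.keys g"
      by (auto simp: lookup_hasse_deriv in_keys_iff)
    \<comment> \<open>Maximality of \<open>M p\<close> compares the two monomials, and their common
      part \<open>c p\<close> cancels.\<close>
    have "w (b q) + w (c p) \<le> w (b p) + w (c p)"
      using M(3)[OF p key] by (simp add: w_add flip: bc[OF p])
    then have le: "w (b q) \<le> w (b p)" by simp
    show "q = p \<or> w (b q) < w (b p)"
    proof (cases "w (b q) = w (b p)")
      case True
      \<comment> \<open>Equal weights give equal margins; after cancelling those of
        \<open>c p\<close>, the nonzero margins spell out both index sets.\<close>
      then have "w (b q + c p) = w (M p)" by (simp add: w_add flip: bc[OF p])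
      from sep[OF key M(1)[OF p] this[unfolded w_def]]
      have "row_sum N (b q) i = row_sum N (b p) i" "col_sum N (b q) i = col_sum N (b p) i"
        if "i < N" for i
        using that by (auto simp: row_sum_add col_sum_add simp flip: bc[OF p])
      then have "i \<in> fst q \<longleftrightarrow> i \<in> fst p" "i \<in> snd q \<longleftrightarrow> i \<in> snd p" if "i < N" for i
        unfolding row[OF p, symmetric] row[OF q, symmetric] col[OF p, symmetric] col[OF q, symmetric]
        using that by simp_all
      moreover have "i < N" if "i \<in> fst q \<or> i \<in> fst p \<or> i \<in> snd q \<or> i \<in> snd p" for i
        using p q A that by (auto simp: minor_indices_def)
      ultimately have "fst q = fst p \<and> snd q = snd p"
        by (intro conjI set_eqI) blast+
      then show ?thesis by (simp add: prod_eq_iff)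
    qed (use le in simp)
  qed
qed

text \<open>The square matrix may have size greater than \<open>r\<close>; this only increases the
  count of index pairs.\<close>

lemma dimension_hasse_lower_bound:
  fixes f :: "(nat \<times> nat, 'a::field) mpoly"
  assumes f: "f \<in> det_ideal n m r" "f \<noteq> 0" and Q: "CHAR('a) = 0 \<or> (\<forall>n. Q n)"
  shows "(\<Sum>i | i \<le> r \<and> Q i. (r choose i)\<^sup>2) \<le> dimension (module.span scale
    {hasse_deriv a f | a. Poly_Mapping.keys a \<subseteq> mat_vars n m \<and> Q (norm1 a)})"
proof -
  obtain A and l :: "nat \<times> nat \<Rightarrow> nat \<times> nat \<Rightarrow> 'a fls" where A: "A \<subseteq> {..<n}" "r \<le> card A"
    and g: "linear_subst l (A \<times> A) fls_const f \<noteq> 0"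
    and sing: "vanishes_on_dependent_columns A (linear_subst l (A \<times> A) fls_const f)"
    using square_reduction[OF f] by blast
  have "finite A" using A(1) finite_subset by blast
  obtain b c and \<omega> :: "nat set \<times> nat set \<Rightarrow> int" where
    "\<And>p. p \<in> minor_indices A Q \<Longrightarrow> Q (norm1 (b p))"
    "\<And>p. p \<in> minor_indices A Q \<Longrightarrow>
      Poly_Mapping.lookup (hasse_deriv (b p) (linear_subst l (A \<times> A) fls_const f)) (c p) \<noteq> 0"
    "\<And>p q. p \<in> minor_indices A Q \<Longrightarrow> q \<in> minor_indices A Q \<Longrightarrow>
      Poly_Mapping.lookup (hasse_deriv (b q) (linear_subst l (A \<times> A) fls_const f)) (c p) \<noteq> 0 \<Longrightarrow>
      q = p \<or> \<omega> q < \<omega> p"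
    using hasse_triangular_family[OF A(1) g linear_subst_carrier sing Q] by blast
  note family = this
  have "(\<Sum>i | i \<le> r \<and> Q i. (r choose i)\<^sup>2) \<le> card (minor_indices A Q)"
    unfolding card_minor_indices(2)[OF \<open>finite A\<close>] by (rule sum_choose_squares_mono[OF A(2)])
  also have "\<dots> \<le> dimension (mpoly.span
    {hasse_deriv a f | a. Poly_Mapping.keys a \<subseteq> mat_vars n m \<and> Q (norm1 a)})"
  proof (rule card_le_dimension_hasse[where l = l and W = "A \<times> A" and \<phi> = fls_const
        and b = b and c = c and \<omega> = \<omega>])
    show "\<forall>a\<in>Poly_Mapping.keys f. Poly_Mapping.keys a \<subseteq> mat_vars n m"
      using det_ideal_carrier[OF f(1)] by (simp add: poly_ring_carrier_iff)
  qed (fact fls_const_hom card_minor_indices(1)[OF \<open>finite A\<close>] family)+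
  finally show ?thesis .
qed

subsection \<open>Hasse derivatives of the generic determinant\<close>

text \<open>The determinant is the minor on all rows and columns, since \<open>pick\<close>
  enumerates an initial segment identically.\<close>

lemma generic_det_in_det_ideal: "(generic_det r :: (nat \<times> nat, 'a::field) mpoly) \<in> det_ideal r r r"
proof -
  have pick: "pick {..<r} i = i" if "i < r" for i
  proof -
    have "{a \<in> {..<r}. a < i} = {..<i}" using that by auto
    then show ?thesis using pick_card_in_set[of i "{..<r}"] that by simp
  qed
  have "{i. i < r \<and> i \<in> {..<r}} = {..<r}" by auto
  then have "submatrix (generic_mat r r :: (nat \<times> nat, 'a) mpoly mat) {..<r} {..<r} = generic_mat r r"
    by (intro eq_matI) (simp_all add: submatrix_def generic_mat_def pick)
  then have "generic_det r \<in> minors r (generic_mat r r :: (nat \<times> nat, 'a) mpoly mat)"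
    unfolding minors_def generic_det_def
    by (intro CollectI exI[of _ "{..<r}"]) (simp add: generic_mat_def)
  then show ?thesis
    by (auto simp: det_ideal_def genideal_def)
qed

lemma generic_det_nonzero: "(generic_det r :: (nat \<times> nat, 'a::field) mpoly) \<noteq> 0"
proof -
  let ?ev = "evaluate (\<lambda>x::'a. x) (\<lambda>(i, j). if i = j then 1 else 0) :: (nat \<times> nat, 'a) mpoly \<Rightarrow> 'a"
  interpret id: comm_ring_hom "\<lambda>x::'a. x" by (rule comm_ring_hom_id)
  interpret ev: comm_ring_hom ?ev by (rule id.evaluate_hom)
  have "?ev (generic_det r) = det (map_mat ?ev (generic_mat r r))"
    unfolding generic_det_def by (rule ev.hom_det[symmetric])
  also have "map_mat ?ev (generic_mat r r) = 1\<^sub>m r"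
    by (rule eq_matI) (simp_all add: generic_mat_def)
  finally have "?ev (generic_det r) = 1" by (simp only: det_one)
  then show ?thesis using ev.hom_zero zero_neq_one by metis
qed

abbreviation graph_monomial :: "(nat \<Rightarrow> nat) \<Rightarrow> nat set \<Rightarrow> (nat \<times> nat) \<Rightarrow>\<^sub>0 nat" where
  "graph_monomial \<pi> I \<equiv> graph_exponent \<pi> I (\<lambda>_. 1)"

lemma generic_det_altdef:
  "(generic_det r :: (nat \<times> nat, 'a::comm_ring_1) mpoly) =
    (\<Sum>p | p permutes {0..<r}. Poly_Mapping.single (graph_monomial p {0..<r}) (of_int (sign p)))"
proof -
  have prod: "(\<Prod>i\<in>I. Var (i, p i) :: (nat \<times> nat, 'a) mpoly) = Poly_Mapping.single (graph_monomial p I) 1"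
    for I p
    by (induction I rule: infinite_finite_induct)
      (simp_all add: graph_exponent_def Var_def mult_single)
  have carrier: "generic_mat r r \<in> carrier_mat r r" by (simp add: generic_mat_def)
  have "(\<Prod>i = 0..<r. generic_mat r r $$ (i, p i)) = (\<Prod>i = 0..<r. Var (i, p i) :: (nat \<times> nat, 'a) mpoly)"
    if "p permutes {0..<r}" for p
    using permutes_in_image[OF that] by (intro prod.cong) (auto simp: generic_mat_def)
  then have "(generic_det r :: (nat \<times> nat, 'a) mpoly) =
      (\<Sum>p | p permutes {0..<r}. of_int (sign p) * Poly_Mapping.single (graph_monomial p {0..<r}) 1)"
    unfolding generic_det_def det_def'[OF carrier] by (intro sum.cong refl) (simp only: prod mem_Collect_eq)
  moreover have "of_int c * Poly_Mapping.single m 1 = Poly_Mapping.single m (of_int c :: 'a)" for c and m :: "(nat \<times> nat) \<Rightarrow>\<^sub>0 nat"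
    by (simp add: mult_single flip: single_of_int)
  ultimately show ?thesis by simp
qed

lemma graph_monomial_decompose:
  assumes "finite N" "I \<subseteq> N" "\<And>i. i \<in> I \<Longrightarrow> \<sigma> i = p i"
  shows "graph_monomial p I + graph_monomial \<sigma> (N - I) = graph_monomial \<sigma> N"
  using assms finite_subset[OF assms(2,1)]
  by (intro poly_mapping_eqI) (auto simp: lookup_add lookup_graph_exponent split: prod.splits)

text \<open>All exponents are 0 or 1, so the binomial factor is 1 and the derivative strips the
  variables over \<open>I\<close> if they are all present.\<close>

lemma hasse_deriv_graph_monomial:
  assumes "finite N" "I \<subseteq> N"
  shows "hasse_deriv (graph_monomial p I) (Poly_Mapping.single (graph_monomial \<sigma> N) x) =
    (if \<forall>i\<in>I. \<sigma> i = p i then Poly_Mapping.single (graph_monomial \<sigma> (N - I)) x else 0)"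
proof (rule poly_mapping_eqI)
  fix c
  let ?b = "graph_monomial p I"
  have "finite I" using assms finite_subset by blast
  show "Poly_Mapping.lookup (hasse_deriv ?b (Poly_Mapping.single (graph_monomial \<sigma> N) x)) c =
    Poly_Mapping.lookup (if \<forall>i\<in>I. \<sigma> i = p i then Poly_Mapping.single (graph_monomial \<sigma> (N - I)) x else 0) c"
  proof (cases "?b + c = graph_monomial \<sigma> N")
    case True
    have sum: "Poly_Mapping.lookup ?b v + Poly_Mapping.lookup c v = Poly_Mapping.lookup (graph_monomial \<sigma> N) v" for v
      using True by (metis lookup_add)
    have agree: "\<forall>i\<in>I. \<sigma> i = p i"
    proof
      fix i assume "i \<in> I"
      then show "\<sigma> i = p i"
        using sum[of "(i, p i)"] assms(1) \<open>finite I\<close>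
        by (auto simp: lookup_graph_exponent split: if_splits)
    qed
    then have c: "c = graph_monomial \<sigma> (N - I)"
      using True graph_monomial_decompose[OF assms, of \<sigma> p] by (metis add_left_cancel)
    have "exponent_binomial ?b c = 1"
      unfolding exponent_binomial_def
    proof (rule prod.neutral, rule ballI)
      fix v assume "v \<in> Poly_Mapping.keys ?b"
      then have "Poly_Mapping.lookup ?b v \<noteq> 0" by (simp add: in_keys_iff)
      then have "Poly_Mapping.lookup c v = 0"
        using \<open>finite I\<close> assms(1) unfolding c
        by (cases v) (auto simp: lookup_graph_exponent split: if_splits)
      then show "(Poly_Mapping.lookup ?b v + Poly_Mapping.lookup c v choose Poly_Mapping.lookup ?b v) = 1"
        by simp
    qed
    then show ?thesis
      using True agree c by (simp add: lookup_hasse_deriv)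
  next
    case False
    then have "c \<noteq> graph_monomial \<sigma> (N - I)" if "\<forall>i\<in>I. \<sigma> i = p i"
      using graph_monomial_decompose[OF assms, of \<sigma> p] that by auto
    with False show ?thesis
      by (auto simp: lookup_hasse_deriv lookup_single_not_eq)
  qed
qed

lemma hasse_deriv_generic_det:
  assumes "I \<subseteq> {0..<r}"
  shows "hasse_deriv (graph_monomial p I) (generic_det r :: (nat \<times> nat, 'a::comm_ring_1) mpoly) =
    (\<Sum>\<sigma> | \<sigma> permutes {0..<r} \<and> (\<forall>i\<in>I. \<sigma> i = p i).
      Poly_Mapping.single (graph_monomial \<sigma> ({0..<r} - I)) (of_int (sign \<sigma>)))"
proof -
  have "hasse_deriv (graph_monomial p I) (generic_det r :: (nat \<times> nat, 'a) mpoly) =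
    (\<Sum>\<sigma> | \<sigma> permutes {0..<r}. if \<forall>i\<in>I. \<sigma> i = p i
      then Poly_Mapping.single (graph_monomial \<sigma> ({0..<r} - I)) (of_int (sign \<sigma>)) else 0)"
    unfolding generic_det_altdef hasse_deriv_sum
    by (intro sum.cong refl hasse_deriv_graph_monomial assms) simp
  also have "\<dots> = (\<Sum>\<sigma> | \<sigma> permutes {0..<r} \<and> (\<forall>i\<in>I. \<sigma> i = p i).
      Poly_Mapping.single (graph_monomial \<sigma> ({0..<r} - I)) (of_int (sign \<sigma>)))"
    by (intro sum.mono_neutral_cong_right) (auto simp: finite_permutations)
  finally show ?thesis .
qed

text \<open>
  The permutations extending \<open>p\<close> on \<open>I\<close> are carried to those extending \<open>p'\<close> by a permutation \<open>\<theta>\<close>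
  of the common image, so the Hasse derivative depends only up to sign on the pair of index sets.
\<close>

lemma hasse_deriv_generic_det_sign:
  assumes I: "I \<subseteq> {0..<r}" and p: "p permutes {0..<r}" and p': "p' permutes {0..<r}"
    and image: "p ` I = p' ` I"
  shows "\<exists>\<epsilon>. hasse_deriv (graph_monomial p' I) (generic_det r :: (nat \<times> nat, 'a::field) mpoly) =
    scale \<epsilon> (hasse_deriv (graph_monomial p I) (generic_det r))"
proof -
  define J where "J = p ` I"
  have J: "J \<subseteq> {0..<r}" using I permutes_image[OF p] by (auto simp: J_def)
  have bij: "bij_betw p I J" "bij_betw p' I J"
    using permutes_inj_on[OF p] permutes_inj_on[OF p'] image by (simp_all add: J_def bij_betw_def)
  define \<theta> where "\<theta> y = (if y \<in> J then p' (inv_into I p y) else y)" for y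
  have \<theta>p: "\<theta> (p i) = p' i" if "i \<in> I" for i
    using that bij(1) by (auto simp: \<theta>_def J_def bij_betw_def inv_into_f_f)
  have "bij_betw (p' \<circ> inv_into I p) J J"
    using bij_betw_trans[OF bij_betw_inv_into[OF bij(1)] bij(2)] .
  then have "bij_betw \<theta> J J"
    by (subst bij_betw_cong[of _ _ "p' \<circ> inv_into I p"]) (auto simp: \<theta>_def)
  then have "\<theta> permutes J"
    by (rule bij_imp_permutes) (simp add: \<theta>_def)
  then have \<theta>: "\<theta> permutes {0..<r}" by (rule permutes_subset[OF _ J])
  let ?S = "\<lambda>p. {\<sigma>. \<sigma> permutes {0..<r} \<and> (\<forall>i\<in>I. \<sigma> i = p i)}"
  \<comment> \<open>Since \<open>\<sigma>\<close> maps \<open>I\<close> onto \<open>J\<close>, its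
    values off \<open>I\<close> avoid \<open>J\<close> and are fixed by \<open>\<theta>\<close>;
    this keeps the remaining monomial unchanged.\<close>
  have off: "\<theta> (\<sigma> i) = \<sigma> i" if "\<sigma> \<in> ?S p" "i \<notin> I" for \<sigma> i
  proof -
    have "\<sigma> i \<notin> J"
    proof
      assume "\<sigma> i \<in> J"
      then obtain i' where i': "i' \<in> I" "\<sigma> i = p i'" by (auto simp: J_def)
      then have "\<sigma> i = \<sigma> i'" using that(1) by simp
      moreover have "inj \<sigma>" using that(1) permutes_inj by blast
      ultimately have "i = i'" by (simp add: inj_eq)
      then show False using that(2) i'(1) by simp
    qed
    then show ?thesis by (simp add: \<theta>_def)
  qed
  have bij_S: "bij_betw ((\<circ>) \<theta>) (?S p) (?S p')"
  proof (rule bij_betw_byWitness[where f' = "(\<circ>) (inv_into UNIV \<theta>)"])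
    show "\<forall>\<sigma>\<in>?S p. inv_into UNIV \<theta> \<circ> (\<theta> \<circ> \<sigma>) = \<sigma>" "\<forall>\<sigma>\<in>?S p'. \<theta> \<circ> (inv_into UNIV \<theta> \<circ> \<sigma>) = \<sigma>"
      by (simp_all add: fun_eq_iff permutes_inverses[OF \<theta>])
    show "(\<circ>) \<theta> ` ?S p \<subseteq> ?S p'"
      using \<theta>p permutes_compose[OF _ \<theta>] by auto
    show "(\<circ>) (inv_into UNIV \<theta>) ` ?S p' \<subseteq> ?S p"
    proof
      fix \<tau> assume "\<tau> \<in> (\<circ>) (inv_into UNIV \<theta>) ` ?S p'"
      then obtain \<sigma> where \<sigma>: "\<sigma> permutes {0..<r}" "\<forall>i\<in>I. \<sigma> i = p' i"
        and \<tau>: "\<tau> = inv_into UNIV \<theta> \<circ> \<sigma>" by auto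
      have "\<tau> permutes {0..<r}"
        unfolding \<tau> by (rule permutes_compose[OF \<sigma>(1) permutes_inv[OF \<theta>]])
      moreover have "\<tau> i = p i" if "i \<in> I" for i
        using \<sigma>(2) that permutes_inverses(2)[OF \<theta>, of "p i"] by (simp add: \<tau> \<theta>p)
      ultimately show "\<tau> \<in> ?S p" by simp
    qed
  qed
  have "hasse_deriv (graph_monomial p' I) (generic_det r :: (nat \<times> nat, 'a) mpoly) =
    (\<Sum>\<sigma>\<in>?S p'. Poly_Mapping.single (graph_monomial \<sigma> ({0..<r} - I)) (of_int (sign \<sigma>)))"
    by (rule hasse_deriv_generic_det[OF I])
  also have "\<dots> = (\<Sum>\<sigma>\<in>?S p.
      Poly_Mapping.single (graph_monomial (\<theta> \<circ> \<sigma>) ({0..<r} - I)) (of_int (sign (\<theta> \<circ> \<sigma>))))"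
    by (rule sum.reindex_bij_betw[OF bij_S, symmetric])
  also have "\<dots> = (\<Sum>\<sigma>\<in>?S p. scale (of_int (sign \<theta>))
      (Poly_Mapping.single (graph_monomial \<sigma> ({0..<r} - I)) (of_int (sign \<sigma>))))"
  proof (rule sum.cong[OF refl])
    fix \<sigma> assume \<sigma>: "\<sigma> \<in> ?S p"
    have "graph_monomial (\<theta> \<circ> \<sigma>) ({0..<r} - I) = graph_monomial \<sigma> ({0..<r} - I)"
      unfolding graph_exponent_def using off[OF \<sigma>] by (intro sum.cong) auto
    moreover have "sign (\<theta> \<circ> \<sigma>) = sign \<theta> * sign \<sigma>"
      using \<theta> \<sigma> by (intro sign_compose) (auto simp: permutation_permutes)
    ultimately show "Poly_Mapping.single (graph_monomial (\<theta> \<circ> \<sigma>) ({0..<r} - I)) (of_int (sign (\<theta> \<circ> \<sigma>))) =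
        scale (of_int (sign \<theta>)) (Poly_Mapping.single (graph_monomial \<sigma> ({0..<r} - I)) (of_int (sign \<sigma>) :: 'a))"
      by (simp add: scale_def Const_def mult_single del: single_of_int)
  qed
  also have "\<dots> = scale (of_int (sign \<theta>)) (hasse_deriv (graph_monomial p I) (generic_det r))"
    unfolding hasse_deriv_generic_det[OF I] mpoly.scale_sum_right ..
  finally show ?thesis by blast
qed

text \<open>A nonzero derivative requires \<open>b\<close> to divide the squarefree monomial of some
  permutation, and such divisors are given by subsets of its graph.\<close>

lemma hasse_deriv_generic_det_nonzeroE:
  assumes "hasse_deriv b (generic_det r :: (nat \<times> nat, 'a::comm_ring_1) mpoly) \<noteq> 0"
  obtains p I where "p permutes {0..<r}" "I \<subseteq> {0..<r}" "b = graph_monomial p I"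
proof -
  obtain c where "Poly_Mapping.lookup (hasse_deriv b (generic_det r :: (nat \<times> nat, 'a) mpoly)) c \<noteq> 0"
    using assms by (metis lookup_zero poly_mapping_eqI)
  then have "Poly_Mapping.lookup (generic_det r :: (nat \<times> nat, 'a) mpoly) (b + c) \<noteq> 0"
    by (auto simp: lookup_hasse_deriv)
  then obtain p where p: "p permutes {0..<r}" "graph_monomial p {0..<r} = b + c"
    unfolding generic_det_altdef lookup_sum
    by (metis (no_types, lifting) lookup_single_not_eq mem_Collect_eq sum.neutral)
  have le: "Poly_Mapping.lookup b (i, j) \<le> (if i \<in> {0..<r} \<and> j = p i then 1 else 0)" for i j
    using arg_cong[OF p(2), of "\<lambda>m. Poly_Mapping.lookup m (i, j)"]
    by (auto simp: lookup_graph_exponent lookup_add split: if_splits)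
  define I where "I = {i \<in> {0..<r}. Poly_Mapping.lookup b (i, p i) \<noteq> 0}"
  have "b = graph_monomial p I"
  proof (rule poly_mapping_eqI)
    fix v :: "nat \<times> nat"
    show "Poly_Mapping.lookup b v = Poly_Mapping.lookup (graph_monomial p I) v"
      using le[of "fst v" "snd v"] 
      by (cases v) (auto simp: lookup_graph_exponent I_def split: if_splits)
  qed
  then show ?thesis using p(1) by (intro that[of p I]) (auto simp: I_def)
qed

text \<open>One derivative for each pair of index sets spans, since the choice of permutation
  matters only up to a scalar. The pairs are counted by Vandermonde's identity.\<close>

lemma dimension_hasse_space_generic_det_le:
  "dimension (hasse_space (mat_vars r r) (generic_det r :: (nat \<times> nat, 'a::field) mpoly)) \<le> (2 * r) choose r"
proof -
  let ?D = "\<lambda>b. hasse_deriv b (generic_det r :: (nat \<times> nat, 'a) mpoly)"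
  let ?P = "minor_indices {0..<r} (\<lambda>_. True)"
  have "\<exists>\<pi>. \<pi> permutes {0..<r} \<and> \<pi> ` fst p = snd p" if "p \<in> ?P" for p
    using that exists_permutation_image[of "{0..<r}" "fst p" "snd p"]
    by (auto simp: minor_indices_def)
  then obtain \<pi> where \<pi>: "\<And>p. p \<in> ?P \<Longrightarrow> \<pi> p permutes {0..<r}" "\<And>p. p \<in> ?P \<Longrightarrow> \<pi> p ` fst p = snd p"
    by metis
  define T where "T = (\<lambda>p. ?D (graph_monomial (\<pi> p) (fst p))) ` ?P"
  have "finite T" by (simp add: T_def card_minor_indices(1))
  have in_span: "?D b \<in> mpoly.span T" for b
  proof (cases "?D b = 0")
    case False
    then obtain p I where p: "p permutes {0..<r}" "I \<subseteq> {0..<r}" "b = graph_monomial p I"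
      by (rule hasse_deriv_generic_det_nonzeroE)
    have "card (p ` I) = card I"
      using permutes_inj_on[OF p(1)] by (rule card_image)
    moreover have "p ` I \<subseteq> {0..<r}"
      using p(2) permutes_image[OF p(1)] by blast
    ultimately have P: "(I, p ` I) \<in> ?P"
      using p(2) by (simp add: minor_indices_def)
    have "\<exists>\<epsilon>. ?D b = scale \<epsilon> (?D (graph_monomial (\<pi> (I, p ` I)) I))"
      unfolding p(3)
      using \<pi>[OF P] by (intro hasse_deriv_generic_det_sign p) simp_all
    moreover have "?D (graph_monomial (\<pi> (I, p ` I)) I) \<in> T"
      unfolding T_def using P by force
    ultimately show ?thesis
      by (metis mpoly.span_base mpoly.span_scale)
  qed (simp add: mpoly.span_zero)
  have "hasse_space (mat_vars r r) (generic_det r :: (nat \<times> nat, 'a) mpoly) \<subseteq> mpoly.span T"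
    unfolding hasse_space_def using in_span
    by (intro mpoly.span_minimal mpoly.subspace_span) auto
  then have "dimension (hasse_space (mat_vars r r) (generic_det r :: (nat \<times> nat, 'a) mpoly)) \<le> card T"
    using \<open>finite T\<close> by (rule mpoly.dim_le_card)
  also have "card T \<le> card ?P"
    unfolding T_def by (rule card_image_le) (simp add: card_minor_indices(1))
  also have "\<dots> = (\<Sum>i\<le>r. (r choose i)\<^sup>2)"
    by (simp add: card_minor_indices(2) atMost_def)
  also have "\<dots> = (2 * r) choose r" by (rule choose_square_sum)
  finally show ?thesis .
qed

theorem theorem5p4:
  fixes n m r :: nat
  shows "(\<forall>f \<in> (det_ideal n m r :: (nat \<times> nat, 'a::field) mpoly set). f \<noteq> 0 \<longrightarrow>
            (2 * r) choose r \<le> dimension (hasse_space (mat_vars n m) f))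
       \<and> dimension (hasse_space (mat_vars r r) (generic_det r :: (nat \<times> nat, 'a) mpoly))
            = (2 * r) choose r
       \<and> (CHAR('a) = 0 \<longrightarrow>
            (\<forall>f \<in> (det_ideal n m r :: (nat \<times> nat, 'a) mpoly set). f \<noteq> 0 \<longrightarrow>
              (\<forall>d. (\<Sum>i = 0..d. (r choose i)^2)
                 \<le> dimension (hasse_space_le (mat_vars n m) d f))))"
proof -
  have lower: "(2 * r) choose r \<le> dimension (hasse_space (mat_vars n m) f)"
    if "f \<in> det_ideal n m r" "f \<noteq> 0" for n m and f :: "(nat \<times> nat, 'a) mpoly"
    using dimension_hasse_lower_bound[OF that, of "\<lambda>_. True"] choose_square_sum[of r]
    by (simp add: hasse_space_def atMost_def)
  have lower_le: "(\<Sum>i = 0..d. (r choose i)^2) \<le> dimension (hasse_space_le (mat_vars n m) d f)"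
    if "CHAR('a) = 0" "f \<in> det_ideal n m r" "f \<noteq> 0" for d and f :: "(nat \<times> nat, 'a) mpoly"
  proof -
    \<comment> \<open>Binomials with \<open>i > r\<close> are zero, so the index may be capped at
      \<open>r\<close>.\<close>
    have "(\<Sum>i = 0..d. (r choose i)^2) = (\<Sum>i | i \<le> r \<and> i \<le> d. (r choose i)^2)"
      by (rule sum.mono_neutral_cong_right) (auto simp: binomial_eq_0)
    also have "\<dots> \<le> dimension (hasse_space_le (mat_vars n m) d f)"
      using dimension_hasse_lower_bound[OF that(2,3), of "\<lambda>i. i \<le> d"] that(1)
      by (simp add: hasse_space_le_def)
    finally show ?thesis .
  qed
  \<comment> \<open>The generic determinant is a nonzero element of its own ideal, so for it the
    lower bound with n = m = r meets the upper bound.\<close>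
  show ?thesis
    using lower lower_le
      antisym[OF dimension_hasse_space_generic_det_le lower[OF generic_det_in_det_ideal generic_det_nonzero]]
    by blast
qed

end
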